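(* There are exactly 19 oriented affine equivalence classes of connected lattice nets in $\mathbb{R}^3$ with adjacency depth 1.
   Context: A (proper) linear 3-periodic net in $\mathbb{R}^3$ is a pair $\mathcal{N}=(N,S)$ where (i) $S$, the set of edges, is a countable set of line segments $[p,q]$, $p\ne q$, which are essentially disjoint (two distinct segments meet at most in a common endpoint); (ii) $N$, the set of nodes, is the set of endpoints of members of $S$; (iii) there is a basis $\underline{a}=\{a_1,a_2,a_3\}$ of $\mathbb{R}^3$ such that $N$ and $S$ are invariant under the group $\mathcal{T}(\underline{a})$ of translations $T_k:x\mapsto x+k_1a_1+k_2a_2+k_3a_3$, $k\in\mathbb{Z}^3$; (iv) $N$ and $S$ partition into finitely many $\mathcal{T}(\underline{a})$-orbits. Such a basis is a periodicity basis; it is primitive if there is no periodicity basis $\underline{b}$ with $\mathcal{T}(\underline{a})$ a proper subset of $\mathcal{T}(\underline{b})$. The net is connected if its structure graph (vertices the nodes, edges the segments in $S$) is connected. The labelled quotient graph $\mathrm{LQG}(\mathcal{N};\underline{a})$: its vertices correspond to $\mathcal{T}(\underline{a})$-orbits of nodes, with chosen representatives $p(v)$; its edges correspond to orbits of edges, and an edge $[T_kp(v),T_lp(w)]$ gives an edge directed from $v$ to $w$ labelled $k-l\in\mathbb{Z}^3$ ($(vw,m)$ being identified with $(wv,-m)$). (When there is a single vertex the labels, up to sign, do not depend on the representative.) The quotient graph of $\mathcal{N}$ is the unlabelled multigraph underlying $\mathrm{LQG}(\mathcal{N};\underline{a})$ for a primitive periodicity basis $\underline{a}$. The depth of a labelled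 quotient graph is the maximum modulus of the coordinates of its edge labels; the adjacency depth $\nu(\mathcal{N})$ is the minimum of the depths of $\mathrm{LQG}(\mathcal{N};\underline{a})$ over all primitive periodicity bases $\underline{a}$. A lattice net is a proper linear 3-periodic net whose quotient graph is a bouquet graph, i.e. has a single vertex (so that its set of nodes is a translate of a lattice in $\mathbb{R}^3$). Nets $\mathcal{N}_1,\mathcal{N}_2$ are orientedly affinely equivalent if there are translates of $\mathcal{N}_1$ and $\mathcal{N}_2$ such that one is carried to the other by a matrix $X\in GL^+(3,\mathbb{R})$ (invertible with positive determinant). *)

theory Defs
  imports "HOL-Analysis.Analysis"
begin

section \<open>Multigraphs\<close>

text \<open>Undirected multigraphs; loops have a singleton set of ends.\<close>

record ('v, 'e) multigraph =
  verts :: "'v set"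
  edges :: "'e set"
  ends :: "'e \<Rightarrow> 'v set"

text \<open>
  Labelled multigraphs with labels in \<open>\<int>\<^sup>3\<close>.  An edge directed from \<open>v\<close> to \<open>w\<close> with label \<open>m\<close>
  is identified with the edge directed from \<open>w\<close> to \<open>v\<close> with label \<open>- m\<close>; accordingly \<open>darts e\<close> is
  the set \<open>{(v, w, m), (w, v, - m)}\<close> of both directed forms of the edge \<open>e\<close>.
\<close>

record ('v, 'e) labelled_multigraph = "('v, 'e) multigraph" +
  darts :: "'e \<Rightarrow> ('v \<times> 'v \<times> (int ^ 3)) set"

definition multigraph_connected :: "('v, 'e) multigraph \<Rightarrow> bool" where
  "multigraph_connected G \<longleftrightarrow>
     (\<forall>u\<in>verts G. \<forall>v\<in>verts G. (u, v) \<in> {(x, y). \<exists>e\<in>edges G. ends G e = {x, y}}\<^sup>*)"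

definition bouquet_graph :: "('v, 'e) multigraph \<Rightarrow> bool" where
  "bouquet_graph G \<longleftrightarrow> (\<exists>v. verts G = {v})"

definition lqg_depth :: "('v, 'e) labelled_multigraph \<Rightarrow> nat" where
  "lqg_depth G = Max {nat \<bar>m $ i\<bar> | m i. \<exists>e\<in>edges G. \<exists>v w. (v, w, m) \<in> darts G e}"


section \<open>Linear 3-periodic nets\<close>

text \<open>A net is the pair of its set of nodes and its set of edges, which are line segments.\<close>

type_synonym net = "(real ^ 3) set \<times> (real ^ 3) set set"

abbreviation nodes :: "net \<Rightarrow> (real ^ 3) set" where
  "nodes \<equiv> fst"

abbreviation segments :: "net \<Rightarrow> (real ^ 3) set set" where
  "segments \<equiv> snd"

definition endpoints :: "(real ^ 3) set \<Rightarrow> (real ^ 3) set" where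
  "endpoints s = {p. \<exists>q. s = closed_segment p q}"

definition translation :: "(3 \<Rightarrow> real ^ 3) \<Rightarrow> int ^ 3 \<Rightarrow> real ^ 3 \<Rightarrow> real ^ 3" where
  "translation a k x = x + (\<Sum>i\<in>UNIV. of_int (k $ i) *\<^sub>R a i)"

definition translation_group :: "(3 \<Rightarrow> real ^ 3) \<Rightarrow> (real ^ 3 \<Rightarrow> real ^ 3) set" where
  "translation_group a = range (translation a)"

definition node_orbit :: "(3 \<Rightarrow> real ^ 3) \<Rightarrow> real ^ 3 \<Rightarrow> (real ^ 3) set" where
  "node_orbit a x = (\<lambda>T. T x) ` translation_group a"

definition edge_orbit :: "(3 \<Rightarrow> real ^ 3) \<Rightarrow> (real ^ 3) set \<Rightarrow> (real ^ 3) set set" where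
  "edge_orbit a s = (\<lambda>T. T ` s) ` translation_group a"

definition basis_of_space :: "(3 \<Rightarrow> real ^ 3) \<Rightarrow> bool" where
  "basis_of_space a \<longleftrightarrow> inj a \<and> independent (range a) \<and> span (range a) = UNIV"

definition periodicity_basis :: "net \<Rightarrow> (3 \<Rightarrow> real ^ 3) \<Rightarrow> bool" where
  "periodicity_basis \<N> a \<longleftrightarrow>
     basis_of_space a \<and>
     (\<forall>T\<in>translation_group a. T ` nodes \<N> = nodes \<N> \<and> image T ` segments \<N> = segments \<N>) \<and>
     finite (node_orbit a ` nodes \<N>) \<and>
     finite (edge_orbit a ` segments \<N>)"

definition primitive_basis :: "net \<Rightarrow> (3 \<Rightarrow> real ^ 3) \<Rightarrow> bool" where
  "primitive_basis \<N> a \<longleftrightarrow>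
     periodicity_basis \<N> a \<and>
     \<not> (\<exists>b. periodicity_basis \<N> b \<and> translation_group a \<subset> translation_group b)"

definition proper_linear_3_periodic_net :: "net \<Rightarrow> bool" where
  "proper_linear_3_periodic_net \<N> \<longleftrightarrow>
     countable (segments \<N>) \<and>
     (\<forall>s\<in>segments \<N>. \<exists>p q. p \<noteq> q \<and> s = closed_segment p q) \<and>
     (\<forall>s\<in>segments \<N>. \<forall>t\<in>segments \<N>. s \<noteq> t \<longrightarrow>
        s \<inter> t = {} \<or> (\<exists>x. x \<in> endpoints s \<and> x \<in> endpoints t \<and> s \<inter> t = {x})) \<and>
     nodes \<N> = (\<Union>s\<in>segments \<N>. endpoints s) \<and>
     (\<exists>a. periodicity_basis \<N> a)"

definition structure_graph :: "net \<Rightarrow> (real ^ 3, (real ^ 3) set) multigraph" where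
  "structure_graph \<N> = \<lparr>verts = nodes \<N>, edges = segments \<N>, ends = endpoints\<rparr>"

definition connected_net :: "net \<Rightarrow> bool" where
  "connected_net \<N> \<longleftrightarrow> multigraph_connected (structure_graph \<N>)"


section \<open>Labelled quotient graphs\<close>

definition orbit_representatives ::
    "net \<Rightarrow> (3 \<Rightarrow> real ^ 3) \<Rightarrow> ((real ^ 3) set \<Rightarrow> real ^ 3) \<Rightarrow> bool" where
  "orbit_representatives \<N> a p \<longleftrightarrow> (\<forall>v\<in>node_orbit a ` nodes \<N>. p v \<in> v)"

definition LQG_darts ::
    "net \<Rightarrow> (3 \<Rightarrow> real ^ 3) \<Rightarrow> ((real ^ 3) set \<Rightarrow> real ^ 3) \<Rightarrow>
     (real ^ 3) set set \<Rightarrow> ((real ^ 3) set \<times> (real ^ 3) set \<times> (int ^ 3)) set" where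
  "LQG_darts \<N> a p e =
     {(v, w, k - l) | v w k l.
        v \<in> node_orbit a ` nodes \<N> \<and> w \<in> node_orbit a ` nodes \<N> \<and>
        closed_segment (translation a k (p v)) (translation a l (p w)) \<in> e}"

definition LQG ::
    "net \<Rightarrow> (3 \<Rightarrow> real ^ 3) \<Rightarrow> ((real ^ 3) set \<Rightarrow> real ^ 3) \<Rightarrow>
     ((real ^ 3) set, (real ^ 3) set set) labelled_multigraph" where
  "LQG \<N> a p =
     \<lparr>verts = node_orbit a ` nodes \<N>,
      edges = edge_orbit a ` segments \<N>,
      ends = (\<lambda>e. {v. \<exists>w m. (v, w, m) \<in> LQG_darts \<N> a p e}),
      darts = LQG_darts \<N> a p\<rparr>"

text \<open>
  All primitive periodicity bases of a net generate the same translation group, and the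
  underlying unlabelled graph does not depend on the orbit representatives, so a net with at least
  one edge has exactly one quotient graph.
\<close>

definition is_quotient_graph ::
    "net \<Rightarrow> ((real ^ 3) set, (real ^ 3) set set) multigraph \<Rightarrow> bool" where
  "is_quotient_graph \<N> G \<longleftrightarrow>
     (\<exists>a p. primitive_basis \<N> a \<and> orbit_representatives \<N> a p \<and>
            G = multigraph.truncate (LQG \<N> a p))"

text \<open>
  The depth may depend on the orbit representatives if there are several vertices, in which case
  the minimum is also taken over these; for a single vertex it does not.
\<close>

definition adjacency_depth :: "net \<Rightarrow> nat" where
  "adjacency_depth \<N> =
     (LEAST d. \<exists>a p. primitive_basis \<N> a \<and> orbit_representatives \<N> a p \<and>
                     d = lqg_depth (LQG \<N> a p))"

definition lattice_net :: "net \<Rightarrow> bool" where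
  "lattice_net \<N> \<longleftrightarrow>
     proper_linear_3_periodic_net \<N> \<and> (\<exists>G. is_quotient_graph \<N> G \<and> bouquet_graph G)"


section \<open>Oriented affine equivalence\<close>

definition map_net :: "(real ^ 3 \<Rightarrow> real ^ 3) \<Rightarrow> net \<Rightarrow> net" where
  "map_net f \<N> = (f ` nodes \<N>, image f ` segments \<N>)"

definition oriented_affine_equiv :: "net \<Rightarrow> net \<Rightarrow> bool" where
  "oriented_affine_equiv \<N>\<^sub>1 \<N>\<^sub>2 \<longleftrightarrow>
     (\<exists>(u :: real ^ 3) (v :: real ^ 3) (X :: real ^ 3 ^ 3).
        det X > 0 \<and> map_net ((*v) X) (map_net ((+) u) \<N>\<^sub>1) = map_net ((+) v) \<N>\<^sub>2)"

end

theory Submission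
  imports Defs
begin

text \<open>
  The nodes of a lattice net form a translate of the lattice spanned by a primitive periodicity
  basis, so in the coordinates of that basis the net consists of the edges \<open>[k, k + m]\<close> with
  \<open>k \<in> \<int>\<^sup>3\<close> and \<open>m\<close> in a finite symmetric set of labels.  Adjacency depth 1 says that for a suitable
  basis all labels lie in \<open>{-1, 0, 1}\<^sup>3\<close>.  Everything else about the net can be read off its labels.

  Two labels that agree modulo 2 and are not opposite give two edges with the same midpoint, so in a
  proper net they cannot occur together.  Conversely, for labels in \<open>{-1, 0, 1}\<^sup>3\<close> this is the only
  obstruction: two labels that differ modulo 2 have a minor equal to \<open>1\<close> or \<open>-1\<close>, which forces the
  parameters of a crossing to be integers (lemma \<open>segments_meet_in_endpoints\<close>).  Connectedness means
  that the labels generate \<open>\<int>\<^sup>3\<close>.  Label sets with these properties are called admissible below; they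
  are exactly the label sets of the nets in question, up to equivalence
  (\<open>net_equiv_admissible_label_net\<close>, \<open>lattice_net_label_net\<close>, \<open>connected_label_net\<close>,
  \<open>adjacency_depth_label_net\<close>).

  An affine map between two such nets preserves the lattice, so it acts on the labels by a matrix in
  \<open>GL(3, \<int>)\<close>, and every such matrix occurs (\<open>unimodular_image_if_label_nets_equiv\<close>,
  \<open>label_net_equiv_if_unimodular_image\<close>).  Orientation does not matter: \<open>x \<mapsto> - x\<close> reverses
  orientation in dimension 3 but fixes every symmetric label set.  It remains to count the orbits of
  \<open>GL(3, \<int>)\<close> on admissible label sets.

  For the upper bound, a signed permutation of the coordinates brings an admissible set into one of
  112 normal forms (\<open>admissible_normal_form\<close>, \<open>sorted_triple_wlog\<close>).  A finite computation shows that
  each normal form either fails to generate \<open>\<int>\<^sup>3\<close> or is carried to one of nineteen representatives by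
  an explicit matrix (\<open>sorted_codes_classified\<close>).  For the lower bound, the number of labels and the
  determinant of the matrix \<open>\<Sum>v. v v\<^sup>T\<close>, summed over the labels \<open>v\<close>, are invariants under
  \<open>GL(3, \<int>)\<close>, and this pair takes nineteen different values on the representatives
  (\<open>distinct_invariants\<close>).
\<close>

section \<open>Affine maps and oriented affine equivalence\<close>

lemma endpoints_closed_segment: "endpoints (closed_segment p q) = {p, q}"
  by (auto simp: endpoints_def doubleton_eq_iff)

definition affine_map :: "real ^ 3 ^ 3 \<Rightarrow> real ^ 3 \<Rightarrow> real ^ 3 \<Rightarrow> real ^ 3" where
  "affine_map X c x = X *v x + c"

lemma affine_map_segment:
  "affine_map X c ` closed_segment p q = closed_segment (affine_map X c p) (affine_map X c q)"
proof -
  have "affine_map X c = (+) c \<circ> (*v) X"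
    by (auto simp: affine_map_def)
  then have "affine_map X c ` closed_segment p q = (+) c ` ((*v) X ` closed_segment p q)"
    by (simp add: image_comp)
  also have "\<dots> = closed_segment (c + X *v p) (c + X *v q)"
    by (simp only: closed_segment_linear_image[OF matrix_vector_mul_linear, symmetric]
        closed_segment_translation)
  finally show ?thesis
    by (simp add: affine_map_def add.commute)
qed

lemma affine_map_compose:
  "affine_map X c (affine_map Y d x) = affine_map (X ** Y) (X *v d + c) x"
  by (simp add: affine_map_def matrix_vector_right_distrib matrix_vector_mul_assoc)

lemma affine_map_id: "affine_map (mat 1) 0 = id"
  by (auto simp: affine_map_def)

lemma map_net_compose: "map_net f (map_net g \<N>) = map_net (f \<circ> g) \<N>"
  by (auto simp: map_net_def image_comp comp_def image_image)

lemma map_net_id: "map_net id \<N> = \<N>"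
  by (simp add: map_net_def)

lemma oriented_affine_equiv_iff:
  "oriented_affine_equiv \<N> \<M> \<longleftrightarrow> (\<exists>X c. det X > 0 \<and> map_net (affine_map X c) \<N> = \<M>)"
proof
  assume "oriented_affine_equiv \<N> \<M>"
  then obtain u v X where X: "det X > 0"
    and eq: "map_net ((*v) X) (map_net ((+) u) \<N>) = map_net ((+) v) \<M>"
    unfolding oriented_affine_equiv_def by blast
  have "affine_map X (X *v u - v) = (+) (- v) \<circ> (*v) X \<circ> (+) u"
    by (auto simp: affine_map_def matrix_vector_right_distrib)
  then have "map_net (affine_map X (X *v u - v)) \<N> =
        map_net ((+) (- v)) (map_net ((*v) X) (map_net ((+) u) \<N>))"
    by (simp add: map_net_compose comp_assoc)
  also have "\<dots> = map_net ((+) (- v)) (map_net ((+) v) \<M>)"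
    by (simp only: eq)
  also have "\<dots> = map_net id \<M>"
    by (simp add: map_net_compose comp_def id_def)
  finally show "\<exists>X c. det X > 0 \<and> map_net (affine_map X c) \<N> = \<M>"
    using X map_net_id by auto
next
  assume "\<exists>X c. det X > 0 \<and> map_net (affine_map X c) \<N> = \<M>"
  then obtain X c where X: "det X > 0" and eq: "map_net (affine_map X c) \<N> = \<M>"
    by blast
  have "map_net ((+) (- c)) \<M> = map_net ((*v) X) (map_net ((+) 0) \<N>)"
    by (simp add: eq[symmetric] map_net_compose affine_map_def comp_def)
  then show "oriented_affine_equiv \<N> \<M>"
    unfolding oriented_affine_equiv_def using X by metis
qed

lemma equiv_oriented_affine_equiv:
  "equiv UNIV {(\<N>\<^sub>1, \<N>\<^sub>2). oriented_affine_equiv \<N>\<^sub>1 \<N>\<^sub>2}"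
proof (intro equivI)
  show "refl {(\<N>\<^sub>1, \<N>\<^sub>2). oriented_affine_equiv \<N>\<^sub>1 \<N>\<^sub>2}"
  proof (rule refl_onI)
    fix \<N> :: net
    have "det (mat 1 :: real^3^3) > 0" by simp
    then show "(\<N>, \<N>) \<in> {(\<N>\<^sub>1, \<N>\<^sub>2). oriented_affine_equiv \<N>\<^sub>1 \<N>\<^sub>2}"
      using affine_map_id map_net_id
      by (metis (mono_tags) case_prodI mem_Collect_eq oriented_affine_equiv_iff)
  qed
  show "sym {(\<N>\<^sub>1, \<N>\<^sub>2). oriented_affine_equiv \<N>\<^sub>1 \<N>\<^sub>2}"
  proof (rule symI, clarify)
    fix \<N> \<M> :: net
    assume "oriented_affine_equiv \<N> \<M>"
    then obtain X c where X: "det X > 0" and eq: "map_net (affine_map X c) \<N> = \<M>"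
      unfolding oriented_affine_equiv_iff by blast
    then obtain Y where Y: "Y ** X = mat 1"
      by (metis invertible_det_nz invertible_left_inverse less_irrefl)
    then have "det Y * det X = 1"
      by (metis det_I det_mul)
    then have "det Y > 0"
      using X by (metis zero_less_mult_pos2 zero_less_one)
    moreover have "map_net (affine_map Y (- (Y *v c))) \<M> = \<N>"
      by (simp add: eq[symmetric] map_net_compose comp_def affine_map_compose Y affine_map_id
          map_net_id flip: id_def)
    ultimately show "oriented_affine_equiv \<M> \<N>"
      unfolding oriented_affine_equiv_iff by blast
  qed
  show "trans {(\<N>\<^sub>1, \<N>\<^sub>2). oriented_affine_equiv \<N>\<^sub>1 \<N>\<^sub>2}"
  proof (rule transI, clarify)
    fix \<N> \<M> \<L> :: net
    assume "oriented_affine_equiv \<N> \<M>" "oriented_affine_equiv \<M> \<L>"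
    then obtain X c Y d where "det X > 0" "map_net (affine_map X c) \<N> = \<M>"
      "det Y > 0" "map_net (affine_map Y d) \<M> = \<L>"
      unfolding oriented_affine_equiv_iff by blast
    then have "det (Y ** X) > 0 \<and> map_net (affine_map (Y ** X) (Y *v c + d)) \<N> = \<L>"
      by (auto simp: det_mul map_net_compose comp_def affine_map_compose)
    then show "oriented_affine_equiv \<N> \<L>"
      unfolding oriented_affine_equiv_iff by blast
  qed
qed simp

section \<open>Integer vectors and unimodular matrices\<close>

definition real_vec :: "int ^ 3 \<Rightarrow> real ^ 3" where
  "real_vec k = (\<chi> i. of_int (k $ i))"

definition real_mat :: "int ^ 3 ^ 3 \<Rightarrow> real ^ 3 ^ 3" where
  "real_mat g = (\<chi> i j. of_int (g $ i $ j))"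

lemma real_vec_nth [simp]: "real_vec k $ i = of_int (k $ i)"
  by (simp add: real_vec_def)

lemma real_vec_add: "real_vec (k + l) = real_vec k + real_vec l"
  and real_vec_diff: "real_vec (k - l) = real_vec k - real_vec l"
  and real_vec_minus: "real_vec (- k) = - real_vec k"
  and real_vec_0 [simp]: "real_vec 0 = 0"
  by (simp_all add: vec_eq_iff)

lemma real_vec_inject [simp]: "real_vec k = real_vec l \<longleftrightarrow> k = l"
  by (simp add: vec_eq_iff)

lemma real_mat_mult_vec: "real_mat g *v real_vec k = real_vec (g *v k)"
  by (simp add: vec_eq_iff matrix_vector_mult_def real_mat_def)

lemma det_real_mat: "det (real_mat g) = of_int (det g)"
  by (simp add: det_3 real_mat_def)

text \<open>
  A matrix over \<open>\<int>\<close> is invertible over \<open>\<int>\<close> if and only if its determinant is a unit.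
\<close>

definition unimodular :: "int ^ 3 ^ 3 \<Rightarrow> bool" where
  "unimodular g \<longleftrightarrow> \<bar>det g\<bar> = 1"

lemma unimodular_mult: "unimodular g \<Longrightarrow> unimodular h \<Longrightarrow> unimodular (g ** h)"
  by (simp add: unimodular_def det_mul abs_mult)

lemma unimodular_if_right_inverse:
  assumes "g ** h = mat 1" shows "unimodular g"
proof -
  have "det g * det h = 1" by (metis assms det_I det_mul)
  then show ?thesis
    by (auto simp: unimodular_def zmult_eq_1_iff)
qed

text \<open>The inverse is the determinant times the adjugate matrix.\<close>

lemma unimodular_inverse:
  assumes "unimodular g"
  obtains h where "g ** h = mat 1" "h ** g = mat 1"
proof
  \<comment> \<open>The entries of the adjugate: indices in the type \<open>3\<close> are added modulo 3, which builds in the signs.\<close>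
  define c where "c i j = g $ (j + 1) $ (i + 1) * g $ (j + 2) $ (i + 2) -
      g $ (j + 1) $ (i + 2) * g $ (j + 2) $ (i + 1)"
    for i j :: 3
  define h :: "int^3^3" where "h = (\<chi> i j. det g * c i j)"
  have sq: "det g * det g = 1"
    using assms by (auto simp: unimodular_def abs_if split: if_splits)
  have nums: "(4::3) = 1" "(5::3) = 2"
    by simp_all
  have "(g ** h) $ i $ j = det g * (\<Sum>k\<in>UNIV. g $ i $ k * c k j)" for i j
    by (simp add: matrix_matrix_mult_def h_def sum_distrib_left mult_ac)
  moreover have "(\<Sum>k\<in>UNIV. g $ i $ k * c k j) = (if i = j then det g else 0)" for i j
    using exhaust_3[of i] exhaust_3[of j]
    by (auto simp: c_def sum_3 det_3 nums algebra_simps)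
  ultimately show "g ** h = mat 1"
    by (simp add: vec_eq_iff mat_def sq)
  have "(h ** g) $ i $ j = det g * (\<Sum>k\<in>UNIV. c i k * g $ k $ j)" for i j
    by (simp add: matrix_matrix_mult_def h_def sum_distrib_left mult_ac)
  moreover have "(\<Sum>k\<in>UNIV. c i k * g $ k $ j) = (if i = j then det g else 0)" for i j
    using exhaust_3[of i] exhaust_3[of j]
    by (auto simp: c_def sum_3 det_3 nums algebra_simps)
  ultimately show "h ** g = mat 1"
    by (simp add: vec_eq_iff mat_def sq)
qed

section \<open>Nets given by labels\<close>

text \<open>
  The edges run through all translates of the labels, so the net determines its labels only up to sign;
  all label sets of interest are symmetric.
\<close>

definition label_net :: "(int ^ 3) set \<Rightarrow> net" where
  "label_net E = (range real_vec, {closed_segment (real_vec k) (real_vec (k + m)) | k m. m \<in> E})"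

text \<open>
  For symmetric \<open>E\<close> this says that the subgroup generated by \<open>E\<close> is everything.  The formulation as an
  induction principle is the one that matches walks along edges.
\<close>

definition generates :: "(int ^ 3) set \<Rightarrow> bool" where
  "generates E \<longleftrightarrow> (\<forall>S. 0 \<in> S \<longrightarrow> (\<forall>k\<in>S. \<forall>m\<in>E. k + m \<in> S) \<longrightarrow> S = UNIV)"

text \<open>
  The third condition excludes two edges that cross in their common midpoint.
\<close>

definition admissible :: "(int ^ 3) set \<Rightarrow> bool" where
  "admissible E \<longleftrightarrow>
     (\<forall>m\<in>E. m \<noteq> 0 \<and> (\<forall>i. \<bar>m $ i\<bar> \<le> 1)) \<and> (\<forall>m\<in>E. - m \<in> E) \<and>
     (\<forall>m\<in>E. \<forall>n\<in>E. (\<forall>i. even (m $ i - n $ i)) \<longrightarrow> n = m \<or> n = - m) \<and> generates E"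

lemma nodes_label_net [simp]: "nodes (label_net E) = range real_vec"
  by (simp add: label_net_def)

lemma segments_label_net:
  "segments (label_net E) = {closed_segment (real_vec k) (real_vec (k + m)) | k m. m \<in> E}"
  by (simp add: label_net_def)

lemma segments_map_label_net:
  "segments (map_net (affine_map X c) (label_net E)) =
     {closed_segment (affine_map X c (real_vec k)) (affine_map X c (real_vec (k + m))) | k m. m \<in> E}"
proof -
  have "F ` {G k m | k m. m \<in> E} = {F (G k m) | k m. m \<in> E}"
    for F :: "(real^3) set \<Rightarrow> (real^3) set" and G :: "int^3 \<Rightarrow> int^3 \<Rightarrow> (real^3) set"
    by auto
  then show ?thesis
    by (simp add: map_net_def segments_label_net affine_map_segment)
qed

lemma segment_in_label_net_iff:
  assumes "\<And>m. m \<in> E \<Longrightarrow> - m \<in> E"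
  shows "closed_segment (real_vec k) (real_vec l) \<in> segments (label_net E) \<longleftrightarrow> l - k \<in> E"
proof
  assume "closed_segment (real_vec k) (real_vec l) \<in> segments (label_net E)"
  then obtain j m where m: "m \<in> E" "{real_vec k, real_vec l} = {real_vec j, real_vec (j + m)}"
    by (auto simp: segments_label_net)
  then have "k = j \<and> l = j + m \<or> k = j + m \<and> l = j"
    by (metis doubleton_eq_iff real_vec_inject)
  then have "l - k = m \<or> l - k = - m" by auto
  with m(1) assms show "l - k \<in> E" by metis
next
  assume "l - k \<in> E"
  then show "closed_segment (real_vec k) (real_vec l) \<in> segments (label_net E)"
    unfolding segments_label_net by (intro CollectI exI[of _ k] exI[of _ "l - k"]) simp
qed

section \<open>Labels of a lattice net\<close>

definition basis_matrix :: "(3 \<Rightarrow> real ^ 3) \<Rightarrow> real ^ 3 ^ 3" where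
  "basis_matrix a = (\<chi> i j. a j $ i)"

lemma translation_eq_affine_map: "translation a k x = affine_map (basis_matrix a) x (real_vec k)"
  by (simp add: translation_def affine_map_def basis_matrix_def vec_eq_iff matrix_vector_mult_def mult.commute)

lemma det_basis_matrix:
  assumes "basis_of_space a" shows "det (basis_matrix a) \<noteq> 0"
proof -
  have "columns (basis_matrix a) = range a"
    by (auto simp: columns_def column_def basis_matrix_def vec_lambda_eta)
  then have "\<exists>B. basis_matrix a ** B = mat 1"
    using assms by (simp add: matrix_right_invertible_span_columns basis_of_space_def span_vec_eq)
  then show ?thesis
    by (simp add: invertible_det_nz[symmetric] invertible_right_inverse)
qed

lemma affine_map_inject:
  assumes "det X \<noteq> 0"
  shows "affine_map X c x = affine_map X c y \<longleftrightarrow> x = y"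
  using assms inj_matrix_vector_mult[of X] by (auto simp: affine_map_def invertible_det_nz inj_eq)

lemma translation_inject:
  assumes "basis_of_space a" shows "translation a k x = translation a l x \<longleftrightarrow> k = l"
  by (simp add: translation_eq_affine_map affine_map_inject det_basis_matrix assms)

lemma translation_add: "translation a k (translation a l x) = translation a (k + l) x"
  by (simp add: translation_def algebra_simps sum.distrib)

lemma translation_0 [simp]: "translation a 0 x = x"
  by (simp add: translation_def)

lemma translation_segment:
  "translation a k ` closed_segment p q = closed_segment (translation a k p) (translation a k q)"
proof -
  have "translation a k = (+) (\<Sum>i\<in>UNIV. of_int (k $ i) *\<^sub>R a i)"
    by (auto simp: translation_def)
  then show ?thesis
    by (simp only: closed_segment_translation)
qed

lemma self_in_node_orbit: "x \<in> node_orbit a x"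
  by (auto simp: node_orbit_def translation_group_def image_iff intro!: exI[of _ 0])

lemma self_in_edge_orbit: "s \<in> edge_orbit a s"
proof -
  have "s = translation a 0 ` s" by simp
  then show ?thesis unfolding edge_orbit_def translation_group_def by blast
qed

lemma node_orbit_subset:
  assumes "periodicity_basis \<N> a" "x \<in> nodes \<N>" shows "node_orbit a x \<subseteq> nodes \<N>"
  using assms by (auto simp: periodicity_basis_def node_orbit_def)

lemma edge_orbit_subset:
  assumes "periodicity_basis \<N> a" "s \<in> segments \<N>" shows "edge_orbit a s \<subseteq> segments \<N>"
proof -
  have "T ` s \<in> segments \<N>" if "T \<in> translation_group a" for T
    using assms that imageI[of s "segments \<N>" "image T"] by (auto simp: periodicity_basis_def)
  then show ?thesis by (auto simp: edge_orbit_def)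
qed

text \<open>
  The quotient graph is defined through some primitive basis \<open>b\<close>, while the depth is a minimum over all
  of them.  If the nodes are a single orbit under the translations of \<open>b\<close>, then every translation
  that preserves the nodes belongs to \<open>b\<close>, so a primitive basis \<open>a\<close> has the same translation group.
\<close>

lemma lattice_net_node_orbits:
  assumes "lattice_net \<N>" "primitive_basis \<N> a"
  shows "node_orbit a ` nodes \<N> = {nodes \<N>}"
proof -
  obtain b q v where b: "primitive_basis \<N> b" "node_orbit b ` nodes \<N> = {v}"
    using assms(1)
    unfolding lattice_net_def is_quotient_graph_def bouquet_graph_def LQG_def
    by (auto simp: multigraph.defs)
  have per: "periodicity_basis \<N> a" "periodicity_basis \<N> b"
    using assms(2) b(1) by (auto simp: primitive_basis_def)
  have orb: "node_orbit b x = nodes \<N>" if "x \<in> nodes \<N>" for x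
  proof
    show "node_orbit b x \<subseteq> nodes \<N>" by (rule node_orbit_subset[OF per(2) that])
    show "nodes \<N> \<subseteq> node_orbit b x"
    proof
      fix y assume "y \<in> nodes \<N>"
      then have "node_orbit b y = node_orbit b x"
        using b(2) that by (metis imageI singletonD)
      then show "y \<in> node_orbit b x" using self_in_node_orbit by metis
    qed
  qed
  obtain x where x: "x \<in> nodes \<N>" using b(2) by blast
  have "translation_group a \<subseteq> translation_group b"
  proof
    fix T assume T: "T \<in> translation_group a"
    then obtain k where k: "T = translation a k" by (auto simp: translation_group_def)
    have "T x \<in> node_orbit b x"
      using orb[OF x] node_orbit_subset[OF per(1) x] T by (auto simp: node_orbit_def)
    then obtain l where "translation a k x = translation b l x"
      by (auto simp: node_orbit_def translation_group_def k)
    then have "translation a k = translation b l"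
      by (auto simp: translation_def)
    then show "T \<in> translation_group b" by (auto simp: k translation_group_def)
  qed
  then have "translation_group a = translation_group b"
    using assms(2) per(2) by (auto simp: primitive_basis_def)
  then have "node_orbit a = node_orbit b"
    by (auto simp: node_orbit_def)
  with orb x show ?thesis by auto
qed

definition edge_labels :: "net \<Rightarrow> (3 \<Rightarrow> real ^ 3) \<Rightarrow> real ^ 3 \<Rightarrow> (int ^ 3) set" where
  "edge_labels \<N> a x = {m. closed_segment x (translation a m x) \<in> segments \<N>}"

text \<open>
  A primitive basis of a lattice net turns the nodes into \<open>\<int>\<^sup>3\<close> once a node is chosen as the origin;
  the single orbit representative serves as this origin.
\<close>

context
  fixes \<N> :: net and a :: "3 \<Rightarrow> real ^ 3" and p :: "(real ^ 3) set \<Rightarrow> real ^ 3" and x :: "real ^ 3"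
  assumes net: "lattice_net \<N>" and prim: "primitive_basis \<N> a"
    and repr: "orbit_representatives \<N> a p" and x: "x = p (nodes \<N>)"
begin

lemma proper_lattice_net: "proper_linear_3_periodic_net \<N>"
  and periodicity_basis_if_primitive: "periodicity_basis \<N> a"
  and basis_if_primitive: "basis_of_space a"
  using net prim by (auto simp: lattice_net_def primitive_basis_def periodicity_basis_def)

lemma representative_is_node: "x \<in> nodes \<N>"
  using repr lattice_net_node_orbits[OF net prim] by (auto simp: orbit_representatives_def x)

lemma nodes_eq_translates: "nodes \<N> = range (\<lambda>k. translation a k x)"
proof -
  have "nodes \<N> = node_orbit a x"
    using lattice_net_node_orbits[OF net prim] representative_is_node by blast
  then show ?thesis by (auto simp: node_orbit_def translation_group_def)
qed

lemma segment_iff_edge_label: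
  "closed_segment (translation a k x) (translation a l x) \<in> segments \<N> \<longleftrightarrow> l - k \<in> edge_labels \<N> a x"
proof -
  have inv: "translation a j ` s \<in> segments \<N>" if "s \<in> segments \<N>" for j s
    using edge_orbit_subset[OF periodicity_basis_if_primitive that] by (auto simp: edge_orbit_def translation_group_def)
  show ?thesis
    using inv[of "closed_segment (translation a k x) (translation a l x)" "- k"]
      inv[of "closed_segment x (translation a (l - k) x)" k]
    by (auto simp: edge_labels_def translation_segment translation_add)
qed

lemma edge_labels_minus: "m \<in> edge_labels \<N> a x \<Longrightarrow> - m \<in> edge_labels \<N> a x"
  using segment_iff_edge_label[of m 0] by (simp add: edge_labels_def closed_segment_commute)

lemma segment_between_nodes:
  assumes "s \<in> segments \<N>"
  obtains k l where "s = closed_segment (translation a k x) (translation a l x)" "k \<noteq> l"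
proof -
  obtain q r where s: "s = closed_segment q r" "q \<noteq> r"
    using proper_lattice_net assms by (auto simp: proper_linear_3_periodic_net_def)
  have "{q, r} \<subseteq> nodes \<N>"
    using proper_lattice_net assms endpoints_closed_segment[of q r] s
    by (auto simp: proper_linear_3_periodic_net_def)
  then show ?thesis
    using that s by (auto simp: nodes_eq_translates)
qed

lemma zero_not_in_edge_labels: "0 \<notin> edge_labels \<N> a x"
proof
  assume "0 \<in> edge_labels \<N> a x"
  then have "closed_segment x x \<in> segments \<N>" by (simp add: edge_labels_def)
  then obtain k l where "closed_segment x x = closed_segment (translation a k x) (translation a l x)"
    "k \<noteq> l" by (rule segment_between_nodes)
  then show False
    using translation_inject[OF basis_if_primitive] by (metis closed_segment_idem closed_segment_eq_sing)
qed

lemma edge_labels_nonempty: "edge_labels \<N> a x \<noteq> {}"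
proof -
  obtain s where "s \<in> segments \<N>"
    using representative_is_node proper_lattice_net by (auto simp: proper_linear_3_periodic_net_def)
  then show ?thesis
    using segment_iff_edge_label by (metis segment_between_nodes empty_iff)
qed

lemma net_eq_label_net:
  "\<N> = map_net (affine_map (basis_matrix a) x) (label_net (edge_labels \<N> a x))"
proof (rule prod_eqI)
  show "nodes \<N> = nodes (map_net (affine_map (basis_matrix a) x) (label_net (edge_labels \<N> a x)))"
    by (auto simp: map_net_def nodes_eq_translates translation_eq_affine_map)
  have "segments \<N> = {closed_segment (translation a k x) (translation a (k + m) x) | k m.
      m \<in> edge_labels \<N> a x}" (is "_ = ?S")
  proof (intro equalityI subsetI)
    fix s assume s: "s \<in> segments \<N>"
    then obtain k l where kl: "s = closed_segment (translation a k x) (translation a l x)"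
      by (rule segment_between_nodes)
    with s have "l - k \<in> edge_labels \<N> a x" by (simp add: segment_iff_edge_label)
    then show "s \<in> ?S" unfolding kl by (intro CollectI exI[of _ k] exI[of _ "l - k"]) simp
  qed (auto simp: segment_iff_edge_label)
  also have "\<dots> = segments (map_net (affine_map (basis_matrix a) x) (label_net (edge_labels \<N> a x)))"
    by (simp add: segments_map_label_net translation_eq_affine_map)
  finally show "segments \<N> = \<dots>" .
qed

text \<open>
  Translates of an edge have the same label up to sign, so each of the finitely many edge orbits
  contributes at most two labels.  Without finiteness the maximum in the definition of the depth would
  carry no information.
\<close>

lemma finite_edge_labels: "finite (edge_labels \<N> a x)"
proof -
  define L where "L e = {l - k | k l. closed_segment (translation a k x) (translation a l x) \<in> e}" for e
  have "finite (L e)" if e: "e \<in> edge_orbit a ` segments \<N>" for e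
  proof -
    obtain s where s: "s \<in> segments \<N>" "e = edge_orbit a s" using e by blast
    obtain k l where kl: "s = closed_segment (translation a k x) (translation a l x)"
      using s(1) by (rule segment_between_nodes)
    have "L e \<subseteq> {l - k, k - l}"
    proof
      fix m assume "m \<in> L e"
      then obtain k' l' j where m: "m = l' - k'"
        and eq: "closed_segment (translation a k' x) (translation a l' x) = translation a j ` s"
        by (auto simp: L_def s(2) edge_orbit_def translation_group_def)
      have "{translation a k' x, translation a l' x} =
            {translation a (j + k) x, translation a (j + l) x}"
        using eq by (simp add: kl translation_segment translation_add)
      then have "k' = j + k \<and> l' = j + l \<or> k' = j + l \<and> l' = j + k"
        by (simp add: doubleton_eq_iff translation_inject[OF basis_if_primitive])
      then show "m \<in> {l - k, k - l}" by (auto simp: m)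
    qed
    then show ?thesis by (rule finite_subset) simp
  qed
  moreover have "finite (edge_orbit a ` segments \<N>)"
    using periodicity_basis_if_primitive by (simp add: periodicity_basis_def)
  moreover have "edge_labels \<N> a x \<subseteq> (\<Union>e\<in>edge_orbit a ` segments \<N>. L e)"
  proof
    fix m assume m: "m \<in> edge_labels \<N> a x"
    define s where "s = closed_segment (translation a 0 x) (translation a m x)"
    have "s \<in> segments \<N>"
      using m by (simp add: s_def edge_labels_def)
    moreover have "m - 0 \<in> L (edge_orbit a s)"
      unfolding L_def using self_in_edge_orbit[of s a] s_def by blast
    ultimately show "m \<in> (\<Union>e\<in>edge_orbit a ` segments \<N>. L e)"
      by auto
  qed
  ultimately show ?thesis
    by (meson finite_UN_I finite_subset)
qed

lemma lqg_depth_eq: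
  "lqg_depth (LQG \<N> a p) = Max {nat \<bar>m $ i\<bar> | m i. m \<in> edge_labels \<N> a x}"
proof -
  have "(\<exists>e\<in>edge_orbit a ` segments \<N>. \<exists>v w. (v, w, m) \<in> LQG_darts \<N> a p e) \<longleftrightarrow>
        m \<in> edge_labels \<N> a x" (is "?L \<longleftrightarrow> _") for m
  proof
    assume ?L
    then obtain e k l where e: "e \<in> edge_orbit a ` segments \<N>" and m: "m = k - l"
      and "closed_segment (translation a k x) (translation a l x) \<in> e"
      unfolding LQG_darts_def lattice_net_node_orbits[OF net prim] by (auto simp: x)
    then have "l - k \<in> edge_labels \<N> a x"
      using edge_orbit_subset[OF periodicity_basis_if_primitive] by (auto simp flip: segment_iff_edge_label)
    then show "m \<in> edge_labels \<N> a x"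
      using edge_labels_minus by (force simp: m)
  next
    assume m: "m \<in> edge_labels \<N> a x"
    define s where "s = closed_segment (translation a m x) (translation a 0 x)"
    have "s \<in> segments \<N>"
      using m edge_labels_minus segment_iff_edge_label[of m 0] by (simp add: s_def)
    moreover have "(nodes \<N>, nodes \<N>, m - 0) \<in> LQG_darts \<N> a p (edge_orbit a s)"
      unfolding LQG_darts_def lattice_net_node_orbits[OF net prim]
      using self_in_edge_orbit[of s a] s_def x by blast
    ultimately show ?L by auto
  qed
  then show ?thesis
    by (simp add: lqg_depth_def LQG_def)
qed

lemma lqg_depth_bounds:
  shows "0 < lqg_depth (LQG \<N> a p)"
    and "m \<in> edge_labels \<N> a x \<Longrightarrow> \<bar>m $ i\<bar> \<le> int (lqg_depth (LQG \<N> a p))"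
proof -
  let ?D = "{nat \<bar>m $ i\<bar> | m i. m \<in> edge_labels \<N> a x}"
  have "?D = (\<lambda>(m, i). nat \<bar>m $ i\<bar>) ` (edge_labels \<N> a x \<times> UNIV)" by auto
  then have fin: "finite ?D" by (simp add: finite_edge_labels)
  obtain n where n: "n \<in> edge_labels \<N> a x" using edge_labels_nonempty by blast
  then have "n \<noteq> 0" using zero_not_in_edge_labels by blast
  then obtain j where "n $ j \<noteq> 0" by (auto simp: vec_eq_iff)
  then have "0 < nat \<bar>n $ j\<bar>" by simp
  also have "\<dots> \<le> Max ?D" by (rule Max_ge[OF fin]) (use n in blast)
  finally show "0 < lqg_depth (LQG \<N> a p)" by (simp add: lqg_depth_eq)
  assume "m \<in> edge_labels \<N> a x"
  then have "nat \<bar>m $ i\<bar> \<le> Max ?D" by (intro Max_ge[OF fin]) blast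
  then show "\<bar>m $ i\<bar> \<le> int (lqg_depth (LQG \<N> a p))" by (simp add: lqg_depth_eq)
qed

end

section \<open>From nets to admissible label sets\<close>

text \<open>
  A walk in the structure graph starting at the origin changes the coordinates by a label at each
  step, so it never leaves a set that is closed under adding labels.
\<close>

lemma generates_edge_labels_if_connected:
  assumes "connected_net \<N>" and net: "lattice_net \<N>" "primitive_basis \<N> a"
    "orbit_representatives \<N> a p" "x = p (nodes \<N>)"
  shows "generates (edge_labels \<N> a x)"
  unfolding generates_def
proof (intro allI impI)
  fix S :: "(int ^ 3) set"
  assume S0: "0 \<in> S" and S: "\<forall>k\<in>S. \<forall>m\<in>edge_labels \<N> a x. k + m \<in> S"
  let ?R = "{(y, z). \<exists>e\<in>segments \<N>. endpoints e = {y, z}}"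
  have reach: "\<exists>k\<in>S. z = translation a k x" if "(x, z) \<in> ?R\<^sup>*" for z
    using that
  proof (induction rule: rtrancl_induct)
    case base
    show ?case using S0 by (intro bexI[of _ 0]) simp_all
  next
    case (step y z)
    then obtain k e where k: "k \<in> S" "y = translation a k x"
      and e: "e \<in> segments \<N>" "endpoints e = {y, z}" by blast
    obtain i j where ij: "e = closed_segment (translation a i x) (translation a j x)"
      using e(1) by (rule segment_between_nodes[OF net])
    with e(1) have "j - i \<in> edge_labels \<N> a x" by (simp add: segment_iff_edge_label[OF net])
    moreover from this have "i - j \<in> edge_labels \<N> a x"
      using edge_labels_minus[OF net] by (metis minus_diff_eq)
    moreover have "{y, z} = {translation a i x, translation a j x}"
      using e(2) by (simp add: ij endpoints_closed_segment)
    ultimately show ?case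
      using k S translation_inject[OF basis_if_primitive[OF net]]
      by (metis add_diff_cancel_left' add_diff_eq diff_add_cancel doubleton_eq_iff add.commute)
  qed
  show "S = UNIV"
  proof (intro UNIV_eq_I[symmetric] ext)
    fix k
    have "(x, translation a k x) \<in> ?R\<^sup>*"
      using assms(1) representative_is_node[OF net] rangeI[of "\<lambda>k. translation a k x" k]
      unfolding nodes_eq_translates[OF net, symmetric]
      by (simp add: connected_net_def multigraph_connected_def structure_graph_def)
    from reach[OF this] show "k \<in> S"
      by (auto simp: translation_inject[OF basis_if_primitive[OF net]])
  qed
qed

text \<open>
  If \<open>m = n + 2 h\<close>, then the edges from \<open>0\<close> to \<open>m\<close> and from \<open>h\<close> to \<open>h + n\<close> share their midpoint, which is
  not an endpoint.  Properness makes them equal, and comparing endpoints gives \<open>h = 0\<close> or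
  \<open>h + n = 0\<close>.
\<close>

lemma edge_labels_eq_if_cong_mod_2:
  assumes net: "lattice_net \<N>" "primitive_basis \<N> a"
    "orbit_representatives \<N> a p" "x = p (nodes \<N>)"
    and m: "m \<in> edge_labels \<N> a x" and n: "n \<in> edge_labels \<N> a x"
    and even: "\<forall>i. even (m $ i - n $ i)"
  shows "n = m \<or> n = - m"
proof -
  define h :: "int ^ 3" where "h = (\<chi> i. (m $ i - n $ i) div 2)"
  have h: "m = h + (h + n)"
    using even by (simp add: h_def vec_eq_iff)
  let ?t = "\<lambda>k. translation a k x"
  define s where "s = closed_segment (?t 0) (?t m)"
  define r where "r = closed_segment (?t h) (?t (h + n))"
  have seg: "s \<in> segments \<N>" "r \<in> segments \<N>"
    unfolding segment_iff_edge_label[OF net] s_def r_def using m n by simp_all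
  define c where "c = midpoint (?t 0) (?t m)"
  have "?t 0 + ?t (i + j) = ?t i + ?t j" for i j
    by (simp add: translation_eq_affine_map affine_map_def real_vec_add
        matrix_vector_right_distrib add_ac)
  then have "?t 0 + ?t m = ?t h + ?t (h + n)"
    using h by metis
  then have c: "c = midpoint (?t h) (?t (h + n))"
    by (simp add: c_def midpoint_def)
  have cs: "c \<in> s \<inter> r"
    unfolding s_def r_def using midpoint_in_closed_segment c c_def by (metis IntI)
  have "m \<noteq> 0"
    using m zero_not_in_edge_labels[OF net] by blast
  then have "?t 0 \<noteq> ?t m"
    using translation_inject[OF basis_if_primitive[OF net]] by metis
  then have "c \<notin> endpoints s"
    by (simp add: c_def s_def endpoints_closed_segment)
  moreover have "s \<inter> r = {} \<or> (\<exists>y. y \<in> endpoints s \<and> y \<in> endpoints r \<and> s \<inter> r = {y})" if "s \<noteq> r"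
    using proper_lattice_net[OF net] seg that by (simp add: proper_linear_3_periodic_net_def)
  ultimately have "s = r"
    using cs by (metis empty_iff singletonD)
  then have "{?t 0, ?t m} = {?t h, ?t (h + n)}"
    by (simp only: s_def r_def closed_segment_eq)
  then have "0 = h \<or> 0 = h + n \<and> m = h"
    unfolding doubleton_eq_iff translation_inject[OF basis_if_primitive[OF net]] by blast
  then show ?thesis
  proof
    assume "0 = h"
    then show ?thesis using h by simp
  next
    assume "0 = h + n \<and> m = h"
    then show ?thesis by (metis add.commute eq_neg_iff_add_eq_0)
  qed
qed

text \<open>
  The central symmetry is the reason why oriented and unoriented equivalence coincide: it lets the
  sign of a determinant be chosen freely.
\<close>

lemma label_net_uminus:
  assumes "\<And>m. m \<in> E \<Longrightarrow> - m \<in> E"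
  shows "map_net (affine_map (- mat 1) 0) (label_net E) = label_net E"
proof (rule prod_eqI)
  have neg: "affine_map (- mat 1) 0 (real_vec k) = real_vec (- k)" for k
    by (simp add: affine_map_def real_vec_minus vec_eq_iff matrix_vector_mult_def mat_def
        forall_3 sum_3)
  show "nodes (map_net (affine_map (- mat 1) 0) (label_net E)) = nodes (label_net E)"
    by (auto simp: map_net_def neg image_image image_iff) (metis minus_minus)
  have "{closed_segment (real_vec (- k)) (real_vec (- (k + m))) | k m. m \<in> E} =
        {closed_segment (real_vec k) (real_vec (k + m)) | k m. m \<in> E}" (is "?A = ?B")
  proof (intro equalityI subsetI)
    fix s assume "s \<in> ?A"
    then obtain k m where "s = closed_segment (real_vec (- k)) (real_vec (- (k + m)))" "m \<in> E"
      by blast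
    then have "s = closed_segment (real_vec (- k)) (real_vec (- k + - m))" "- m \<in> E"
      using assms by (simp_all add: add.commute)
    then show "s \<in> ?B" by blast
  next
    fix s assume "s \<in> ?B"
    then obtain k m where "s = closed_segment (real_vec k) (real_vec (k + m))" "m \<in> E"
      by blast
    then have "s = closed_segment (real_vec (- (- k))) (real_vec (- (- k + - m)))" "- m \<in> E"
      using assms by (simp_all add: add.commute)
    then show "s \<in> ?A" by blast
  qed
  then show "segments (map_net (affine_map (- mat 1) 0) (label_net E)) = segments (label_net E)"
    by (simp add: segments_map_label_net neg segments_label_net)
qed

lemma net_equiv_admissible_label_net:
  assumes net: "lattice_net \<N>" and conn: "connected_net \<N>" and depth: "adjacency_depth \<N> = 1"
  shows "\<exists>E. admissible E \<and> oriented_affine_equiv (label_net E) \<N>"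
proof -
  let ?P = "\<lambda>d. \<exists>a p. primitive_basis \<N> a \<and> orbit_representatives \<N> a p \<and> d = lqg_depth (LQG \<N> a p)"
  have "\<exists>d. ?P d"
    using net by (auto simp: lattice_net_def is_quotient_graph_def)
  then have "?P (adjacency_depth \<N>)"
    unfolding adjacency_depth_def by (rule LeastI_ex)
  then obtain a p where a: "primitive_basis \<N> a" "orbit_representatives \<N> a p"
    and d: "lqg_depth (LQG \<N> a p) = 1"
    using depth by auto
  define x where "x = p (nodes \<N>)"
  note net_a = net a x_def
  define E where "E = edge_labels \<N> a x"
  have minus: "- m \<in> E" if "m \<in> E" for m
    using edge_labels_minus[OF net_a] that by (simp add: E_def)
  have "admissible E"
    unfolding admissible_def
  proof (intro conjI ballI allI impI)
    fix m i assume m: "m \<in> E"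
    show "m \<noteq> 0" using m zero_not_in_edge_labels[OF net_a] by (auto simp: E_def)
    show "\<bar>m $ i\<bar> \<le> 1" using lqg_depth_bounds(2)[OF net_a, of m i] m d by (simp add: E_def)
    show "- m \<in> E" using m by (rule minus)
  next
    fix m n assume "m \<in> E" "n \<in> E" "\<forall>i. even (m $ i - n $ i)"
    then show "n = m \<or> n = - m"
      unfolding E_def by (rule edge_labels_eq_if_cong_mod_2[OF net_a])
  next
    show "generates E"
      unfolding E_def by (rule generates_edge_labels_if_connected[OF conn net_a])
  qed
  moreover have "oriented_affine_equiv (label_net E) \<N>"
  proof (cases "det (basis_matrix a) > 0")
    case True
    then show ?thesis
      unfolding oriented_affine_equiv_iff E_def using net_eq_label_net[OF net_a] by metis
  next
    case False
    have "det (basis_matrix a) \<noteq> 0"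
      by (rule det_basis_matrix[OF basis_if_primitive[OF net_a]])
    moreover have "det (- mat 1 :: real^3^3) = - 1"
      by (simp add: det_3 mat_def)
    ultimately have "det (basis_matrix a ** - mat 1) > 0"
      using False by (simp add: det_mul)
    moreover have "\<N> = map_net (affine_map (basis_matrix a) x)
                     (map_net (affine_map (- mat 1) 0) (label_net E))"
      using net_eq_label_net[OF net_a] by (simp add: label_net_uminus minus E_def[symmetric])
    then have "\<N> = map_net (affine_map (basis_matrix a ** - mat 1) x) (label_net E)"
      by (simp add: map_net_compose comp_def affine_map_compose)
    ultimately show ?thesis
      unfolding oriented_affine_equiv_iff by metis
  qed
  ultimately show ?thesis by blast
qed

section \<open>Equivalence of nets and unimodular maps of labels\<close>

lemma label_net_equiv_if_unimodular_image:
  assumes "unimodular g" and sym: "\<And>m. m \<in> E \<Longrightarrow> - m \<in> E"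
  shows "oriented_affine_equiv (label_net E) (label_net ((*v) g ` E))"
proof -
  have main: "oriented_affine_equiv (label_net E) (label_net ((*v) h ` E))" if h: "det h = 1" for h
  proof -
    obtain h' where h': "h ** h' = mat 1"
      using unimodular_inverse[of h] h by (auto simp: unimodular_def)
    have surj: "h *v (h' *v k) = k" for k
      by (simp add: matrix_vector_mul_assoc h')
    have "map_net (affine_map (real_mat h) 0) (label_net E) = label_net ((*v) h ` E)"
    proof (rule prod_eqI)
      have f: "affine_map (real_mat h) 0 (real_vec k) = real_vec (h *v k)" for k
        by (simp add: affine_map_def real_mat_mult_vec)
      have "real_vec k \<in> range (\<lambda>k. real_vec (h *v k))" for k
        using rangeI[of "\<lambda>k. real_vec (h *v k)" "h' *v k"] by (simp add: surj)
      then have "range (\<lambda>k. real_vec (h *v k)) = range real_vec"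
        by blast
      then show "nodes (map_net (affine_map (real_mat h) 0) (label_net E)) = nodes (label_net ((*v) h ` E))"
        by (simp add: map_net_def image_image f)
      have "{closed_segment (real_vec (h *v k)) (real_vec (h *v (k + m))) | k m. m \<in> E} =
        {closed_segment (real_vec k) (real_vec (k + m)) | k m. m \<in> (*v) h ` E}" (is "?A = ?B")
      proof (intro equalityI subsetI)
        fix s assume "s \<in> ?A"
        then obtain k m where "s = closed_segment (real_vec (h *v k)) (real_vec (h *v (k + m)))" "m \<in> E"
          by blast
        then show "s \<in> ?B"
          by (intro CollectI exI[of _ "h *v k"] exI[of _ "h *v m"]) (simp add: matrix_vector_right_distrib)
      next
        fix s assume "s \<in> ?B"
        then obtain k m where "s = closed_segment (real_vec k) (real_vec (k + h *v m))" "m \<in> E"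
          by blast
        then show "s \<in> ?A"
          by (intro CollectI exI[of _ "h' *v k"] exI[of _ "m"]) (simp add: matrix_vector_right_distrib surj)
      qed
      then show "segments (map_net (affine_map (real_mat h) 0) (label_net E)) =
                 segments (label_net ((*v) h ` E))"
        by (simp add: segments_map_label_net f segments_label_net)
    qed
    moreover have "det (real_mat h) > 0" by (simp add: det_real_mat h)
    ultimately show ?thesis unfolding oriented_affine_equiv_iff by blast
  qed
  show ?thesis
  proof (cases "det g = 1")
    case True
    then show ?thesis by (rule main)
  next
    case False
    then have "det (- g) = 1"
      using assms(1) by (simp add: unimodular_def det_3)
    moreover have "(- g) *v m = g *v (- m)" for m
      by (simp add: vec_eq_iff matrix_vector_mult_def)
    then have "(*v) (- g) ` E = (*v) g ` (uminus ` E)"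
      by (simp add: image_image)
    moreover have "uminus ` E = E"
      using sym by (auto simp: image_iff) (metis minus_minus)
    ultimately show ?thesis
      using main[of "- g"] by simp
  qed
qed

text \<open>
  The linear part \<open>X\<close> of the affine map carries differences of nodes to differences of nodes, so it is
  integral in the standard basis; it is onto \<open>\<int>\<^sup>3\<close>, which gives an integral right inverse.
\<close>

lemma unimodular_image_if_label_nets_equiv:
  assumes "oriented_affine_equiv (label_net E) (label_net F)"
    and E: "\<And>m. m \<in> E \<Longrightarrow> - m \<in> E" and F: "\<And>m. m \<in> F \<Longrightarrow> - m \<in> F"
  obtains g where "unimodular g" "F = (*v) g ` E"
proof -
  obtain X c where map: "map_net (affine_map X c) (label_net E) = label_net F"
    using assms(1) unfolding oriented_affine_equiv_iff by blast
  let ?f = "affine_map X c"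
  have nodes: "?f ` range real_vec = range real_vec"
    using arg_cong[OF map, of nodes] by (simp add: map_net_def)
  have segs: "image ?f ` segments (label_net E) = segments (label_net F)"
    using arg_cong[OF map, of segments] by (simp add: map_net_def)
  have "?f (real_vec 0) \<in> range real_vec" using nodes by blast
  then obtain c0 where c0: "c = real_vec c0" by (auto simp: affine_map_def)
  have "\<exists>l. X *v real_vec k = real_vec l" for k
  proof -
    have "?f (real_vec k) \<in> range real_vec" using nodes by blast
    then obtain l where "X *v real_vec k + real_vec c0 = real_vec l"
      by (auto simp: affine_map_def c0)
    then have "X *v real_vec k = real_vec (l - c0)"
      by (simp add: real_vec_diff eq_diff_eq)
    then show ?thesis by blast
  qed
  then obtain l where l: "\<And>k. X *v real_vec k = real_vec (l k)" by metis
  define g :: "int^3^3" where "g = (\<chi> i j. l (axis j 1) $ i)"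
  have "real_vec (axis j 1) = axis j 1" for j
    by (simp add: vec_eq_iff axis_def)
  then have "X *v axis j 1 = real_vec (l (axis j 1))" for j
    using l by metis
  then have "X $ i $ j = of_int (g $ i $ j)" for i j
    by (metis (no_types, lifting) column_def g_def matrix_vector_mult_basis real_vec_nth vec_lambda_beta)
  then have X: "X = real_mat g"
    by (simp add: vec_eq_iff real_mat_def)
  have f: "?f (real_vec k) = real_vec (g *v k + c0)" for k
    by (simp add: affine_map_def X c0 real_mat_mult_vec real_vec_add)
  have "\<exists>k. g *v k = i" for i
  proof -
    have "real_vec (i + c0) \<in> ?f ` range real_vec" using nodes by blast
    then show ?thesis by (auto simp: f)
  qed
  then obtain k where k: "\<And>i. g *v k i = i" by metis
  define h :: "int^3^3" where "h = (\<chi> i j. k (axis j 1) $ i)"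
  have "(g ** h) $ i $ j = (mat 1 :: int^3^3) $ i $ j" for i j
  proof -
    have "(g ** h) $ i $ j = (g *v k (axis j 1)) $ i"
      by (simp add: matrix_matrix_mult_def matrix_vector_mult_def h_def)
    also have "\<dots> = (mat 1 :: int^3^3) $ i $ j"
      by (simp add: k axis_def mat_def)
    finally show ?thesis .
  qed
  then have "g ** h = mat 1" by (simp add: vec_eq_iff)
  then have "unimodular g" by (rule unimodular_if_right_inverse)
  moreover have "F = (*v) g ` E"
  proof (intro equalityI subsetI)
    fix n assume n: "n \<in> F"
    have "closed_segment (real_vec 0) (real_vec n) \<in> segments (label_net F)"
      by (subst segment_in_label_net_iff) (use F n in auto)
    then obtain j m where m: "m \<in> E"
      and "closed_segment (real_vec 0) (real_vec n) = ?f ` closed_segment (real_vec j) (real_vec (j + m))"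
      unfolding segs[symmetric] by (auto simp: segments_label_net)
    then have "{real_vec 0, real_vec n} = {real_vec (g *v j + c0), real_vec (g *v (j + m) + c0)}"
      by (simp only: affine_map_segment f closed_segment_eq)
    then have "0 = g *v j + c0 \<and> n = g *v (j + m) + c0 \<or> 0 = g *v (j + m) + c0 \<and> n = g *v j + c0"
      unfolding doubleton_eq_iff real_vec_inject .
    then have "n = (g *v (j + m) + c0) - (g *v j + c0) \<or> n = (g *v j + c0) - (g *v (j + m) + c0)"
      by (metis diff_0_right)
    then have "n = g *v m \<or> n = - (g *v m)"
      by (simp add: matrix_vector_right_distrib)
    moreover have "- (g *v m) = g *v (- m)"
      by (simp add: vec_eq_iff matrix_vector_mult_def sum_negf)
    ultimately have "n = g *v m \<or> n = g *v (- m)"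
      by metis
    then show "n \<in> (*v) g ` E" using m E by blast
  next
    fix n assume "n \<in> (*v) g ` E"
    then obtain m where m: "n = g *v m" "m \<in> E" by blast
    have "closed_segment (real_vec 0) (real_vec m) \<in> segments (label_net E)"
      by (subst segment_in_label_net_iff) (use E m in auto)
    then have "?f ` closed_segment (real_vec 0) (real_vec m) \<in> segments (label_net F)"
      using segs by blast
    then have "closed_segment (real_vec c0) (real_vec (n + c0)) \<in> segments (label_net F)"
      by (simp only: affine_map_segment f m) simp
    then show "n \<in> F"
      by (subst (asm) segment_in_label_net_iff) (use F in auto)
  qed
  ultimately show thesis by (rule that)
qed

section \<open>Nets of admissible label sets\<close>

lemma finite_admissible:
  assumes "admissible E" shows "finite E"
proof -
  have "E \<subseteq> (\<lambda>(a, b, c). vector [a, b, c]) ` ({-1..1} \<times> {-1..1} \<times> {-1..1})"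
  proof
    fix m assume "m \<in> E"
    then have "\<bar>m $ i\<bar> \<le> 1" for i using assms by (simp add: admissible_def)
    then have "m $ i \<in> {-1..1}" for i by (simp add: abs_le_iff minus_le_iff)
    moreover have "m = vector [m $ 1, m $ 2, m $ 3]" by (simp add: vec_eq_iff forall_3)
    ultimately show "m \<in> (\<lambda>(a, b, c). vector [a, b, c]) ` ({-1..1} \<times> {-1..1} \<times> {-1..1})"
      by (intro image_eqI[of _ _ "(m $ 1, m $ 2, m $ 3)"]) auto
  qed
  then show ?thesis by (rule finite_subset) simp
qed

text \<open>
  Modulo 2 the two vectors are nonzero and distinct, hence linearly independent over the field with two
  elements, so some two-by-two minor does not vanish there.
\<close>

lemma odd_minor:
  fixes m n :: "int ^ 3"
  assumes m: "m \<noteq> 0" "\<And>i. \<bar>m $ i\<bar> \<le> 1" and n: "n \<noteq> 0" "\<And>i. \<bar>n $ i\<bar> \<le> 1"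
    and incong: "\<not> (\<forall>i. even (m $ i - n $ i))"
  obtains i j where "odd (m $ i * n $ j - m $ j * n $ i)"
proof (rule ccontr)
  assume "\<not> thesis"
  with that have minor: "even (m $ i * n $ j - m $ j * n $ i)" for i j by blast
  have odd_entry: "\<exists>i. odd (v $ i)" if "v \<noteq> 0" "\<And>i. \<bar>v $ i\<bar> \<le> 1" for v :: "int^3"
  proof -
    obtain i where "v $ i \<noteq> 0" using \<open>v \<noteq> 0\<close> by (auto simp: vec_eq_iff)
    then have "odd (v $ i)" using that(2)[of i] by presburger
    then show ?thesis ..
  qed
  obtain i where i: "odd (m $ i)" using odd_entry m by blast
  obtain k where k: "odd (n $ k)" using odd_entry n by blast
  have "odd (n $ i)" using minor[of i k] i k by auto
  then have "even (m $ j - n $ j)" for j using minor[of i j] i by auto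
  with incong show False by blast
qed

text \<open>
  An odd minor of vectors with entries in \<open>{-1, 0, 1}\<close> is at most 2 in absolute value, hence \<open>1\<close> or \<open>-1\<close>.
  By Cramer's rule the solution of the corresponding two equations is then integral.
\<close>

lemma integral_parameter:
  fixes s t :: real and m n d :: "int ^ 3"
  assumes bound: "\<And>i. \<bar>m $ i\<bar> \<le> 1" "\<And>i. \<bar>n $ i\<bar> \<le> 1"
    and odd: "odd (m $ i * n $ j - m $ j * n $ i)"
    and eq: "\<And>i. s * m $ i - t * n $ i = d $ i"
  shows "s \<in> \<int>" "t \<in> \<int>"
proof -
  let ?D = "m $ i * n $ j - m $ j * n $ i"
  have prod_bound: "\<bar>m $ a * n $ b\<bar> \<le> 1" for a b
    using mult_mono[OF bound(1)[of a] bound(2)[of b]] by (simp add: abs_mult)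
  have "\<bar>?D\<bar> \<le> 2"
    using prod_bound[of i j] prod_bound[of j i] by linarith
  moreover have "z = 1 \<or> z = -1" if "\<bar>z\<bar> \<le> 2" "odd z" for z :: int
    using that by presburger
  ultimately have D: "?D = 1 \<or> ?D = -1"
    using odd by blast
  have "s * of_int ?D = of_int (d $ i * n $ j - d $ j * n $ i)"
    by (simp add: eq[symmetric] algebra_simps)
  moreover have "t * of_int ?D = of_int (d $ i * m $ j - d $ j * m $ i)"
    by (simp add: eq[symmetric] algebra_simps)
  ultimately have "s * of_int ?D \<in> \<int>" "t * of_int ?D \<in> \<int>"
    by (metis Ints_of_int)+
  with D show "s \<in> \<int>" "t \<in> \<int>"
    by (auto simp del: of_int_diff of_int_mult)
qed

lemma Ints_unit_interval:
  fixes s :: real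
  assumes "s \<in> \<int>" "0 \<le> s" "s \<le> 1" shows "s = 0 \<or> s = 1"
  using assms by (auto elim!: Ints_cases)

text \<open>
  The difference \<open>s - t\<close> is an integer because \<open>m\<close> has an entry \<open>1\<close> or \<open>-1\<close>.  It is not zero, so the two
  parameters are the two ends of the unit interval.
\<close>

lemma parallel_segments_meet_in_endpoints:
  fixes s t :: real and m d :: "int ^ 3"
  assumes m: "m \<noteq> 0" "\<And>i. \<bar>m $ i\<bar> \<le> 1"
    and s: "0 \<le> s" "s \<le> 1" and t: "0 \<le> t" "t \<le> 1"
    and eq: "\<And>i. s * m $ i - t * m $ i = d $ i"
    and "d \<noteq> 0"
  shows "(s = 0 \<or> s = 1) \<and> (t = 0 \<or> t = 1)"
proof -
  obtain i where "m $ i \<noteq> 0" using \<open>m \<noteq> 0\<close> by (auto simp: vec_eq_iff)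
  then have "m $ i = 1 \<or> m $ i = - 1" using m(2)[of i] by linarith
  then have "s - t = of_int (d $ i * m $ i)"
    using eq[of i] by auto
  then obtain c :: int where c: "s - t = of_int c" by blast
  have "c \<noteq> 0"
  proof
    assume "c = 0"
    then have "d = 0" using c eq by (simp add: vec_eq_iff flip: left_diff_distrib)
    with \<open>d \<noteq> 0\<close> show False ..
  qed
  then have "c \<le> -1 \<or> c \<ge> 1" by linarith
  then have "s - t \<le> - 1 \<or> s - t \<ge> 1" unfolding c by auto
  then show ?thesis using s t by auto
qed

lemma segments_meet_in_endpoints:
  assumes adm: "admissible E" and m: "m \<in> E" and n: "n \<in> E"
    and x: "x \<in> closed_segment (real_vec k) (real_vec (k + m))"
      "x \<in> closed_segment (real_vec l) (real_vec (l + n))"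
    and diff: "{k, k + m} \<noteq> {l, l + n}"
  shows "x \<in> {real_vec k, real_vec (k + m)} \<and> x \<in> {real_vec l, real_vec (l + n)}"
proof -
  have m': "m \<noteq> 0" "\<And>i. \<bar>m $ i\<bar> \<le> 1" and n': "n \<noteq> 0" "\<And>i. \<bar>n $ i\<bar> \<le> 1"
    using adm m n by (auto simp: admissible_def)
  obtain s where s: "0 \<le> s" "s \<le> 1" "x = real_vec k + s *\<^sub>R real_vec m"
    using x(1) by (auto simp: in_segment real_vec_add algebra_simps)
  obtain t where t: "0 \<le> t" "t \<le> 1" "x = real_vec l + t *\<^sub>R real_vec n"
    using x(2) by (auto simp: in_segment real_vec_add algebra_simps)
  have eq: "s * m $ i - t * n $ i = (l - k) $ i" for i
    using arg_cong[OF trans[OF s(3)[symmetric] t(3)], of "\<lambda>v. v $ i"] by simp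
  have "(s = 0 \<or> s = 1) \<and> (t = 0 \<or> t = 1)"
  proof (cases "\<forall>i. even (m $ i - n $ i)")
    case True
    then have "n = m \<or> n = - m" using adm m n by (auto simp: admissible_def)
    then show ?thesis
    proof
      assume nm: "n = m"
      then have "l - k \<noteq> 0" using diff by auto
      then show ?thesis
        using parallel_segments_meet_in_endpoints[OF m' s(1,2) t(1,2), of "l - k"] eq nm by simp
    next
      assume nm: "n = - m"
      \<comment> \<open>Reversing the second segment reduces this to the case of equal labels.\<close>
      then have ne: "l - m - k \<noteq> 0" using diff by (auto simp: algebra_simps)
      have "s * m $ i - (1 - t) * m $ i = (l - m - k) $ i" for i
        using eq[of i] by (simp add: nm algebra_simps)
      then have "(s = 0 \<or> s = 1) \<and> (1 - t = 0 \<or> 1 - t = 1)"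
        using t by (intro parallel_segments_meet_in_endpoints[OF m' s(1,2) _ _ _ ne]) simp_all
      then show ?thesis by auto
    qed
  next
    case False
    then obtain i j where "odd (m $ i * n $ j - m $ j * n $ i)"
      using odd_minor[OF m' n'] by blast
    then have "s \<in> \<int>" "t \<in> \<int>"
      using integral_parameter[OF m'(2) n'(2) _ eq] by blast+
    then show ?thesis using s t Ints_unit_interval by blast
  qed
  then show ?thesis
    using s(3) t(3) by (auto simp: real_vec_add)
qed

definition standard_basis :: "3 \<Rightarrow> real ^ 3" where
  "standard_basis i = axis i 1"

lemma translation_standard_basis: "translation standard_basis k x = x + real_vec k"
  by (simp add: translation_def standard_basis_def vec_eq_iff axis_def forall_3 sum_3)

lemma basis_of_space_standard_basis: "basis_of_space standard_basis"
proof -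
  have "range standard_basis = Basis"
    by (auto simp: standard_basis_def Basis_vec_def)
  moreover have "inj standard_basis"
    by (auto simp: inj_def standard_basis_def axis_eq_axis)
  ultimately show ?thesis
    by (simp add: basis_of_space_def independent_Basis)
qed

text \<open>
  For the net of an admissible label set, the standard basis is primitive, the origin represents the
  only orbit of nodes, and the labels of the quotient graph are the given ones.
\<close>

context
  fixes E assumes adm: "admissible E"
begin

lemma minus_label: "m \<in> E \<Longrightarrow> - m \<in> E"
  using adm by (simp add: admissible_def)

lemma label_exists: obtains m where "m \<in> E"
proof -
  have "E \<noteq> {}"
  proof
    assume "E = {}"
    then have "{0 :: int^3} = UNIV"
      using adm by (auto simp: admissible_def generates_def)
    then have "(1 :: int^3) = 0" by blast
    then show False by simp
  qed
  then show thesis using that by blast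
qed

lemma node_orbit_label_net: "node_orbit standard_basis (real_vec k) = range real_vec"
proof -
  have "real_vec l \<in> node_orbit standard_basis (real_vec k)" for l
    unfolding node_orbit_def translation_group_def image_image
    by (rule image_eqI[of _ _ "l - k"]) (simp_all add: translation_standard_basis real_vec_diff)
  moreover have "y \<in> range real_vec" if "y \<in> node_orbit standard_basis (real_vec k)" for y
    using that by (auto simp: node_orbit_def translation_group_def translation_standard_basis
        simp flip: real_vec_add)
  ultimately show ?thesis by blast
qed

lemma translation_segment_in_label_net:
  assumes "s \<in> segments (label_net E)"
  shows "translation standard_basis j ` s \<in> segments (label_net E)"
proof -
  obtain k m where "s = closed_segment (real_vec k) (real_vec (k + m))" "m \<in> E"
    using assms by (auto simp: segments_label_net)
  then have "translation standard_basis j ` s = closed_segment (real_vec (k + j)) (real_vec (k + j + m))"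
    by (simp only: translation_segment) (simp add: translation_standard_basis real_vec_add add_ac)
  with \<open>m \<in> E\<close> show ?thesis unfolding segments_label_net by blast
qed

lemma periodicity_basis_label_net: "periodicity_basis (label_net E) standard_basis"
  unfolding periodicity_basis_def
proof (intro conjI ballI)
  show "basis_of_space standard_basis" by (rule basis_of_space_standard_basis)
next
  fix T assume "T \<in> translation_group standard_basis"
  then obtain j where T: "T = translation standard_basis j" by (auto simp: translation_group_def)
  let ?T' = "translation standard_basis (- j)"
  have inv: "T (?T' y) = y" for y by (simp add: T translation_add)
  have "T (real_vec k) \<in> range real_vec" "?T' (real_vec k) \<in> range real_vec" for k
    by (simp_all add: T translation_standard_basis flip: real_vec_add)
  then show "T ` nodes (label_net E) = nodes (label_net E)"
    by (auto simp: image_iff) (metis inv)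
  have "image T (image ?T' s) = s" for s by (simp add: image_image inv)
  then show "image T ` segments (label_net E) = segments (label_net E)"
    using translation_segment_in_label_net by (auto simp: T image_iff) metis
next
  show "finite (node_orbit standard_basis ` nodes (label_net E))"
    by (simp add: image_image node_orbit_label_net)
  have "edge_orbit standard_basis s \<in> (\<lambda>m. edge_orbit standard_basis (closed_segment 0 (real_vec m))) ` E"
    if s: "s \<in> segments (label_net E)" for s
  proof -
    obtain k m where km: "s = closed_segment (real_vec k) (real_vec (k + m))" "m \<in> E"
      using s by (auto simp: segments_label_net)
    have "edge_orbit standard_basis s = edge_orbit standard_basis (closed_segment 0 (real_vec m))"
    proof -
      have *: "edge_orbit standard_basis (translation standard_basis j ` r) \<subseteq> edge_orbit standard_basis r" for j r
        by (auto simp: edge_orbit_def translation_group_def image_image translation_add)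
      have "s = translation standard_basis k ` closed_segment 0 (real_vec m)"
        "closed_segment 0 (real_vec m) = translation standard_basis (- k) ` s"
        by (simp_all only: km translation_segment)
          (simp_all add: translation_standard_basis real_vec_add real_vec_minus add_ac)
      then show ?thesis using * by (metis subset_antisym)
    qed
    with km show ?thesis by blast
  qed
  then show "finite (edge_orbit standard_basis ` segments (label_net E))"
    using finite_admissible[OF adm] by (meson finite_imageI finite_subset image_subsetI)
qed

text \<open>
  A translation that preserves the net carries the origin to a node, so it is a translation by an
  integer vector.
\<close>

lemma primitive_basis_label_net: "primitive_basis (label_net E) standard_basis"
  unfolding primitive_basis_def
proof (intro conjI notI)
  show "periodicity_basis (label_net E) standard_basis" by (rule periodicity_basis_label_net)
  assume "\<exists>b. periodicity_basis (label_net E) b \<and> translation_group standard_basis \<subset> translation_group b"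
  then obtain b where b: "periodicity_basis (label_net E) b"
    and sub: "translation_group standard_basis \<subset> translation_group b" by blast
  have "T \<in> translation_group standard_basis" if T: "T \<in> translation_group b" for T
  proof -
    obtain j where j: "T = translation b j" using T by (auto simp: translation_group_def)
    have "T ` range real_vec = range real_vec"
      using b T by (simp add: periodicity_basis_def)
    then have "T (real_vec 0) \<in> range real_vec" by blast
    then obtain k where "T 0 = real_vec k" by auto
    moreover have "T x = x + T 0" for x by (simp add: j translation_def)
    ultimately have "T = translation standard_basis k"
      by (metis (no_types) ext translation_standard_basis)
    then show ?thesis by (simp add: translation_group_def)
  qed
  with sub show False by blast
qed

lemma proper_label_net: "proper_linear_3_periodic_net (label_net E)"
  unfolding proper_linear_3_periodic_net_def
proof (intro conjI ballI impI)
  have "segments (label_net E) = (\<lambda>(k, m). closed_segment (real_vec k) (real_vec (k + m))) ` (UNIV \<times> E)"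
    by (auto simp: segments_label_net)
  then show "countable (segments (label_net E))" by simp
next
  fix s assume "s \<in> segments (label_net E)"
  then obtain k m where km: "s = closed_segment (real_vec k) (real_vec (k + m))" "m \<in> E"
    by (auto simp: segments_label_net)
  have "m \<noteq> 0" using km(2) adm by (auto simp: admissible_def)
  then have "real_vec k \<noteq> real_vec (k + m)" by simp
  with km show "\<exists>p q. p \<noteq> q \<and> s = closed_segment p q" by blast
next
  fix s r assume s: "s \<in> segments (label_net E)" and r: "r \<in> segments (label_net E)" and "s \<noteq> r"
  obtain k m where km: "s = closed_segment (real_vec k) (real_vec (k + m))" "m \<in> E"
    using s by (auto simp: segments_label_net)
  obtain l n where ln: "r = closed_segment (real_vec l) (real_vec (l + n))" "n \<in> E"
    using r by (auto simp: segments_label_net)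
  have "{k, k + m} \<noteq> {l, l + n}"
    using \<open>s \<noteq> r\<close> by (auto simp: km ln doubleton_eq_iff)
  then have meet: "x \<in> {real_vec k, real_vec (k + m)} \<and> x \<in> {real_vec l, real_vec (l + n)}"
    if "x \<in> s \<inter> r" for x
    using segments_meet_in_endpoints[OF adm km(2) ln(2)] that by (auto simp: km ln)
  have unique: "x = y" if "x \<in> s \<inter> r" "y \<in> s \<inter> r" for x y
  proof (rule ccontr)
    assume "x \<noteq> y"
    then have "{real_vec k, real_vec (k + m)} = {real_vec l, real_vec (l + n)}"
      using meet[OF that(1)] meet[OF that(2)] by (metis doubleton_eq_iff insertE singletonD)
    with \<open>s \<noteq> r\<close> show False by (simp add: km ln)
  qed
  show "s \<inter> r = {} \<or> (\<exists>x. x \<in> endpoints s \<and> x \<in> endpoints r \<and> s \<inter> r = {x})"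
  proof (cases "s \<inter> r = {}")
    case False
    then obtain x where x: "x \<in> s \<inter> r" by blast
    then have "s \<inter> r = {x}" using unique by blast
    then show ?thesis using meet[OF x] by (auto simp: km ln endpoints_closed_segment)
  qed simp
next
  obtain m where m: "m \<in> E" by (rule label_exists)
  have "real_vec k \<in> (\<Union>s\<in>segments (label_net E). endpoints s)" for k
    using m by (intro UN_I[of "closed_segment (real_vec k) (real_vec (k + m))"])
      (auto simp: segments_label_net endpoints_closed_segment)
  then show "nodes (label_net E) = (\<Union>s\<in>segments (label_net E). endpoints s)"
    by (auto simp: segments_label_net endpoints_closed_segment)
next
  show "\<exists>a. periodicity_basis (label_net E) a" using periodicity_basis_label_net by blast
qed

lemma lattice_net_label_net: "lattice_net (label_net E)"
proof -
  have "orbit_representatives (label_net E) standard_basis (\<lambda>_. 0)"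
    using rangeI[of real_vec 0]
    by (simp add: orbit_representatives_def image_image node_orbit_label_net)
  moreover have "bouquet_graph (multigraph.truncate (LQG (label_net E) standard_basis (\<lambda>_. 0)))"
    by (simp add: bouquet_graph_def LQG_def multigraph.defs image_image node_orbit_label_net)
  ultimately show ?thesis
    using proper_label_net primitive_basis_label_net
    unfolding lattice_net_def is_quotient_graph_def by blast
qed

lemma connected_label_net: "connected_net (label_net E)"
proof -
  let ?R = "{(y, z). \<exists>e\<in>segments (label_net E). endpoints e = {y, z}}"
  have "(real_vec k, real_vec l) \<in> ?R\<^sup>*" for k l
  proof -
    let ?S = "{j. (real_vec k, real_vec (k + j)) \<in> ?R\<^sup>*}"
    have "j + m \<in> ?S" if j: "j \<in> ?S" and m: "m \<in> E" for j m
    proof -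
      have "closed_segment (real_vec (k + j)) (real_vec (k + j + m)) \<in> segments (label_net E)"
        unfolding segments_label_net using m by blast
      then have "(real_vec (k + j), real_vec (k + (j + m))) \<in> ?R"
        using endpoints_closed_segment[of "real_vec (k + j)" "real_vec (k + j + m)"]
        by (auto simp: add.assoc)
      with j show ?thesis by (auto intro: rtrancl_into_rtrancl)
    qed
    moreover have "generates E" using adm by (simp add: admissible_def)
    ultimately have "?S = UNIV"
      unfolding generates_def by (metis (no_types, lifting) add.right_neutral mem_Collect_eq rtrancl.rtrancl_refl)
    then have "l - k \<in> ?S" by blast
    then show ?thesis by simp
  qed
  then show ?thesis
    by (auto simp: connected_net_def multigraph_connected_def structure_graph_def)
qed

lemma adjacency_depth_label_net: "adjacency_depth (label_net E) = 1"
  unfolding adjacency_depth_def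
proof (rule Least_equality)
  let ?a = standard_basis and ?p = "\<lambda>_ :: (real^3) set. 0 :: real^3"
  have repr: "orbit_representatives (label_net E) ?a ?p"
    using rangeI[of real_vec 0]
    by (simp add: orbit_representatives_def image_image node_orbit_label_net)
  note net = lattice_net_label_net primitive_basis_label_net repr refl
  have labels: "edge_labels (label_net E) ?a 0 = E"
    using segment_in_label_net_iff[of E 0] minus_label
    by (auto simp: edge_labels_def translation_standard_basis)
  have bound: "nat \<bar>m $ i\<bar> \<le> 1" if "m \<in> E" for m i
  proof -
    have "\<bar>m $ i\<bar> \<le> 1" using that adm by (simp add: admissible_def)
    then show ?thesis by simp
  qed
  have "lqg_depth (LQG (label_net E) ?a ?p) \<le> 1"
  proof -
    let ?D = "{nat \<bar>m $ i\<bar> | m i. m \<in> E}"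
    have "?D = (\<lambda>(m, i). nat \<bar>m $ i\<bar>) ` (E \<times> UNIV)" by auto
    then have fin: "finite ?D" by (simp add: finite_admissible[OF adm])
    have "?D \<noteq> {}" using label_exists by blast
    then have "Max ?D \<le> 1" using bound by (subst Max_le_iff[OF fin]) auto
    then show ?thesis by (simp add: lqg_depth_eq[OF net] labels)
  qed
  moreover have "0 < lqg_depth (LQG (label_net E) ?a ?p)"
    by (rule lqg_depth_bounds(1)[OF net])
  ultimately have "lqg_depth (LQG (label_net E) ?a ?p) = 1" by simp
  then show "\<exists>a p. primitive_basis (label_net E) a \<and> orbit_representatives (label_net E) a p \<and>
      1 = lqg_depth (LQG (label_net E) a p)"
    using primitive_basis_label_net repr by metis
next
  fix d assume "\<exists>a p. primitive_basis (label_net E) a \<and> orbit_representatives (label_net E) a p \<and>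
      d = lqg_depth (LQG (label_net E) a p)"
  then show "1 \<le> d"
    using lqg_depth_bounds(1)[OF lattice_net_label_net _ _ refl] by (auto simp: Suc_le_eq)
qed

end

section \<open>Integral equivalence of label sets\<close>

definition integrally_equiv :: "(int ^ 3) set \<Rightarrow> (int ^ 3) set \<Rightarrow> bool" where
  "integrally_equiv E F \<longleftrightarrow> (\<exists>g. unimodular g \<and> F = (*v) g ` E)"

lemma integrally_equiv_trans:
  assumes "integrally_equiv E F" "integrally_equiv F G" shows "integrally_equiv E G"
proof -
  obtain g h where "unimodular g" "F = (*v) g ` E" "unimodular h" "G = (*v) h ` F"
    using assms unfolding integrally_equiv_def by blast
  then have "unimodular (h ** g)" "G = (*v) (h ** g) ` E"
    by (simp_all add: unimodular_mult image_image matrix_vector_mul_assoc)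
  then show ?thesis unfolding integrally_equiv_def by blast
qed

lemma generates_integrally_equiv:
  assumes "integrally_equiv E F" "generates E" shows "generates F"
proof -
  obtain g where g: "unimodular g" "F = (*v) g ` E"
    using assms(1) unfolding integrally_equiv_def by blast
  obtain h where h: "g ** h = mat 1"
    using unimodular_inverse[OF g(1)] by blast
  show ?thesis
    unfolding generates_def
  proof (intro allI impI)
    fix S :: "(int^3) set"
    assume S: "0 \<in> S" "\<forall>k\<in>S. \<forall>m\<in>F. k + m \<in> S"
    let ?S' = "{k. g *v k \<in> S}"
    have "0 \<in> ?S'" "\<forall>k\<in>?S'. \<forall>m\<in>E. k + m \<in> ?S'"
      using S by (auto simp: g(2) matrix_vector_right_distrib)
    then have S': "?S' = UNIV"
      using assms(2) unfolding generates_def by blast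
    have "k \<in> S" for k
    proof -
      have "h *v k \<in> ?S'" using S' by blast
      then show ?thesis by (simp add: matrix_vector_mul_assoc h)
    qed
    then show "S = UNIV" by blast
  qed
qed

text \<open>
  The matrix of the quadratic form \<open>x \<mapsto> \<Sum>v\<in>E. (v \<bullet> x)\<^sup>2\<close>.  By the Cauchy--Binet formula its determinant is
  the sum of the squared determinants of all three-element subsets of \<open>E\<close>.
\<close>

definition gram_matrix :: "(int ^ 3) set \<Rightarrow> int ^ 3 ^ 3" where
  "gram_matrix E = (\<chi> i j. \<Sum>v\<in>E. v $ i * v $ j)"

lemma inj_unimodular:
  assumes "unimodular g" shows "inj ((*v) g)"
proof -
  obtain h where "h ** g = mat 1" using unimodular_inverse[OF assms] by blast
  then have "h *v (g *v x) = x" for x by (simp add: matrix_vector_mul_assoc)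
  then show ?thesis by (metis injI)
qed

lemma gram_matrix_image:
  assumes "unimodular g"
  shows "gram_matrix ((*v) g ` E) = g ** gram_matrix E ** transpose g"
proof -
  have "gram_matrix ((*v) g ` E) $ i $ j = (g ** gram_matrix E ** transpose g) $ i $ j" for i j
  proof -
    have "gram_matrix ((*v) g ` E) $ i $ j = (\<Sum>v\<in>E. (g *v v) $ i * (g *v v) $ j)"
      using inj_unimodular[OF assms]
      by (simp add: gram_matrix_def sum.reindex inj_on_subset[OF _ subset_UNIV])
    also have "\<dots> = (\<Sum>v\<in>E. \<Sum>l\<in>UNIV. \<Sum>k\<in>UNIV. g $ i $ k * (v $ k * v $ l) * g $ j $ l)"
      by (simp add: matrix_vector_mult_def sum_3 algebra_simps)
    also have "\<dots> = (\<Sum>l\<in>UNIV. \<Sum>k\<in>UNIV. \<Sum>v\<in>E. g $ i $ k * (v $ k * v $ l) * g $ j $ l)"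
      by (subst sum.swap, intro sum.cong refl, rule sum.swap)
    also have "\<dots> = (g ** gram_matrix E ** transpose g) $ i $ j"
      by (simp add: matrix_matrix_mult_def gram_matrix_def transpose_def sum_distrib_left
          sum_distrib_right mult.assoc)
    finally show ?thesis .
  qed
  then show ?thesis by (simp add: vec_eq_iff)
qed

lemma integrally_equiv_invariants:
  assumes "integrally_equiv E F"
  shows "card F = card E" "det (gram_matrix F) = det (gram_matrix E)"
proof -
  obtain g where g: "unimodular g" "F = (*v) g ` E"
    using assms unfolding integrally_equiv_def by blast
  show "card F = card E"
    using card_image[OF inj_on_subset[OF inj_unimodular[OF g(1)] subset_UNIV]] by (simp add: g(2))
  have "det g * det g = 1"
    using g(1) by (auto simp: unimodular_def abs_if split: if_splits)
  then show "det (gram_matrix F) = det (gram_matrix E)"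
    by (simp add: g gram_matrix_image det_mul)
qed

section \<open>Label sets given by lists\<close>

text \<open>
  Vectors are represented by triples, matrices by triples of rows and symmetric label sets by lists
  of vectors up to sign, so that statements about concrete label sets can be evaluated.
\<close>

type_synonym triple = "int \<times> int \<times> int"

definition vec_of :: "triple \<Rightarrow> int ^ 3" where
  "vec_of = (\<lambda>(a, b, c). vector [a, b, c])"

fun neg :: "triple \<Rightarrow> triple" where
  "neg (a, b, c) = (- a, - b, - c)"

fun dot :: "triple \<Rightarrow> triple \<Rightarrow> int" where
  "dot (a, b, c) (x, y, z) = a * x + b * y + c * z"

fun apply_rows :: "triple \<times> triple \<times> triple \<Rightarrow> triple \<Rightarrow> triple" where
  "apply_rows (p, q, r) v = (dot p v, dot q v, dot r v)"

fun det_rows :: "triple \<times> triple \<times> triple \<Rightarrow> int" where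
  "det_rows ((a, b, c), (d, e, f), (g, h, i)) = a * (e * i - f * h) - b * (d * i - f * g) + c * (d * h - e * g)"

definition mat_of :: "triple \<times> triple \<times> triple \<Rightarrow> int ^ 3 ^ 3" where
  "mat_of = (\<lambda>(p, q, r). vector [vec_of p, vec_of q, vec_of r])"

definition label_set :: "triple list \<Rightarrow> (int ^ 3) set" where
  "label_set L = vec_of ` (set L \<union> neg ` set L)"

lemma vec_of_nth [simp]:
  "vec_of (a, b, c) $ 1 = a" "vec_of (a, b, c) $ 2 = b" "vec_of (a, b, c) $ 3 = c"
  by (simp_all add: vec_of_def)

lemma vec_of_inject [simp]: "vec_of v = vec_of w \<longleftrightarrow> v = w"
  by (cases v; cases w) (auto simp: vec_eq_iff forall_3)

lemma vec_of_surj: obtains v where "m = vec_of v"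
proof
  show "m = vec_of (m $ 1, m $ 2, m $ 3)" by (simp add: vec_eq_iff forall_3)
qed

lemma vec_of_neg: "vec_of (neg v) = - vec_of v"
  by (cases v) (simp add: vec_eq_iff forall_3)

lemma neg_neg [simp]: "neg (neg v) = v"
  by (cases v) simp

lemma mat_of_mult_vec: "mat_of M *v vec_of v = vec_of (apply_rows M v)"
proof -
  obtain p q r where M: "M = (p, q, r)" by (cases M) auto
  show ?thesis
    by (cases p; cases q; cases r; cases v)
      (simp add: M mat_of_def vec_eq_iff forall_3 matrix_vector_mult_def sum_3)
qed

lemma det_mat_of: "det (mat_of M) = det_rows M"
proof -
  obtain p q r where M: "M = (p, q, r)" by (cases M) auto
  show ?thesis
    by (cases p; cases q; cases r) (simp add: M mat_of_def det_3 algebra_simps)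
qed

lemma apply_rows_neg: "apply_rows M (neg v) = neg (apply_rows M v)"
proof -
  obtain p q r where M: "M = (p, q, r)" by (cases M) auto
  show ?thesis by (cases p; cases q; cases r; cases v) (simp add: M)
qed

lemma mem_label_set: "vec_of v \<in> label_set L \<longleftrightarrow> v \<in> set L \<or> neg v \<in> set L"
proof -
  have "v \<in> neg ` set L \<longleftrightarrow> neg v \<in> set L"
    by (metis imageE imageI neg_neg)
  then show ?thesis
    by (simp add: label_set_def inj_image_mem_iff inj_def)
qed

lemma minus_in_label_set:
  assumes "m \<in> label_set L" shows "- m \<in> label_set L"
proof -
  obtain v where "m = vec_of v" by (rule vec_of_surj)
  with assms show ?thesis by (auto simp: mem_label_set simp flip: vec_of_neg)
qed

text \<open>
  An executable sufficient condition for integral equivalence.  Both inclusions are tested, which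
  makes any bookkeeping about the number of labels superfluous.
\<close>

definition carries :: "triple \<times> triple \<times> triple \<Rightarrow> triple list \<Rightarrow> triple list \<Rightarrow> bool" where
  "carries M L R \<longleftrightarrow> \<bar>det_rows M\<bar> = 1 \<and>
     (\<forall>v\<in>set L. apply_rows M v \<in> set R \<or> neg (apply_rows M v) \<in> set R) \<and>
     (\<forall>w\<in>set R. \<exists>v\<in>set L. w = apply_rows M v \<or> w = neg (apply_rows M v))"

lemma integrally_equiv_if_carries:
  assumes "carries M L R" shows "integrally_equiv (label_set L) (label_set R)"
proof -
  have "unimodular (mat_of M)"
    using assms by (simp add: carries_def unimodular_def det_mat_of)
  moreover have "label_set R = (*v) (mat_of M) ` label_set L"
  proof (intro equalityI subsetI)
    fix m assume m: "m \<in> label_set R"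
    obtain w where w: "m = vec_of w" by (rule vec_of_surj)
    from m have "w \<in> set R \<or> neg w \<in> set R" by (simp add: w mem_label_set)
    then obtain v where v: "v \<in> set L" "w = apply_rows M v \<or> w = neg (apply_rows M v)"
      using assms unfolding carries_def by (metis neg_neg)
    then have "w = apply_rows M v \<or> w = apply_rows M (neg v)" by (simp add: apply_rows_neg)
    then have "m = mat_of M *v vec_of v \<or> m = mat_of M *v vec_of (neg v)"
      by (auto simp: w mat_of_mult_vec)
    then show "m \<in> (*v) (mat_of M) ` label_set L"
      using v(1) by (auto simp: mem_label_set intro!: imageI)
  next
    fix m assume "m \<in> (*v) (mat_of M) ` label_set L"
    then obtain n where n: "n \<in> label_set L" "m = mat_of M *v n" by blast
    obtain v where v: "n = vec_of v" by (rule vec_of_surj)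
    have "v \<in> set L \<or> neg v \<in> set L" using n(1) by (simp add: v mem_label_set)
    then show "m \<in> label_set R"
      using assms by (auto simp: n(2) v mat_of_mult_vec mem_label_set carries_def)
        (metis apply_rows_neg neg_neg)+
  qed
  ultimately show ?thesis unfolding integrally_equiv_def by blast
qed

text \<open>
  Three labels with determinant \<open>1\<close> or \<open>-1\<close> form a basis of \<open>\<int>\<^sup>3\<close>.
\<close>

lemma generates_label_set:
  assumes "u \<in> set L" "v \<in> set L" "w \<in> set L" "\<bar>det_rows (u, v, w)\<bar> = 1"
  shows "generates (label_set L)"
  unfolding generates_def
proof (intro allI impI)
  fix S :: "(int^3) set"
  assume S0: "0 \<in> S" and S: "\<forall>k\<in>S. \<forall>m\<in>label_set L. k + m \<in> S"
  have step: "k + c *s m \<in> S" if m: "m \<in> label_set L" and "k \<in> S" for c k m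
  proof (induction c rule: int_induct[where k = 0])
    case base
    show ?case using \<open>k \<in> S\<close> by simp
  next
    case (step1 i)
    then have "k + i *s m + m \<in> S" using S m by blast
    moreover have "k + (i + 1) *s m = k + i *s m + m"
      by (simp add: vec_eq_iff algebra_simps)
    ultimately show ?case by metis
  next
    case (step2 i)
    then have "k + i *s m + - m \<in> S" using S minus_in_label_set[OF m] by blast
    moreover have "k + (i - 1) *s m = k + i *s m + - m"
      by (simp add: vec_eq_iff algebra_simps)
    ultimately show ?case by metis
  qed
  let ?P = "transpose (mat_of (u, v, w))"
  have mem: "vec_of u \<in> label_set L" "vec_of v \<in> label_set L" "vec_of w \<in> label_set L"
    using assms by (simp_all add: mem_label_set)
  have "unimodular ?P"
    using assms(4) by (simp only: unimodular_def det_transpose det_mat_of)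
  then obtain h where h: "?P ** h = mat 1" by (rule unimodular_inverse)
  have "k \<in> S" for k
  proof -
    define c where "c = h *v k"
    have "k = ?P *v c" by (simp add: c_def matrix_vector_mul_assoc h)
    also have "\<dots> = 0 + c $ 1 *s vec_of u + c $ 2 *s vec_of v + c $ 3 *s vec_of w"
      by (simp add: mat_of_def vec_eq_iff matrix_vector_mult_def sum_3 transpose_def mult.commute)
    finally show ?thesis using S0 step mem by metis
  qed
  then show "S = UNIV" by blast
qed

text \<open>
  A linear functional with a coefficient \<open>1\<close> or \<open>-1\<close> that vanishes modulo \<open>p\<close> on all labels
  confines them to a proper subgroup.
\<close>

lemma not_generates_label_set:
  assumes "p > 1" and c: "\<bar>dot c (1, 0, 0)\<bar> = 1 \<or> \<bar>dot c (0, 1, 0)\<bar> = 1 \<or> \<bar>dot c (0, 0, 1)\<bar> = 1"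
    and L: "\<forall>v\<in>set L. dot c v mod p = 0"
  shows "\<not> generates (label_set L)"
proof
  assume gen: "generates (label_set L)"
  obtain c1 c2 c3 where c123: "c = (c1, c2, c3)" by (cases c) auto
  let ?S = "{k :: int^3. p dvd c1 * k $ 1 + c2 * k $ 2 + c3 * k $ 3}"
  have dot: "c1 * vec_of v $ 1 + c2 * vec_of v $ 2 + c3 * vec_of v $ 3 = dot c v" for v
    by (cases v) (simp add: c123)
  have labels: "m \<in> ?S" if "m \<in> label_set L" for m
  proof -
    obtain v where v: "m = vec_of v" by (rule vec_of_surj)
    have "dot c (neg v) = - dot c v" by (cases v) (simp add: c123)
    then have "p dvd dot c v"
      using L that by (auto simp: v mem_label_set mod_eq_0_iff_dvd)
    then show ?thesis by (simp add: v dot)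
  qed
  have "k + m \<in> ?S" if "k \<in> ?S" "m \<in> label_set L" for k m
  proof -
    have "c1 * (k + m) $ 1 + c2 * (k + m) $ 2 + c3 * (k + m) $ 3 =
      (c1 * k $ 1 + c2 * k $ 2 + c3 * k $ 3) + (c1 * m $ 1 + c2 * m $ 2 + c3 * m $ 3)"
      by (simp add: algebra_simps)
    then show ?thesis using labels[OF that(2)] that(1) by (simp only: mem_Collect_eq dvd_add)
  qed
  then have "?S = UNIV"
    using gen unfolding generates_def by auto
  then have "p dvd dot c v" for v
    unfolding dot[symmetric] by blast
  with c have "p dvd 1"
    by (metis dvd_abs_iff)
  with \<open>p > 1\<close> show False by simp
qed

section \<open>Normal form up to signed permutations of the coordinates\<close>

text \<open>
  The thirteen vectors of \<open>{-1, 0, 1}\<^sup>3\<close> up to sign fall into the seven nonzero classes modulo 2: the three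
  coordinate axes, the two diagonals of a face for each of the three coordinate directions, and the
  four body diagonals of the cube.  An admissible set contains at most one vector of each class.  The
  pair \<open>(a, f)\<close> belonging to a coordinate direction records whether the axis is present and which
  diagonal of the face perpendicular to it is present: the one with equal signs for \<open>f = 1\<close>, the
  one with opposite signs for \<open>f = -1\<close>, and none for \<open>f = 0\<close>.  With this indexing, permuting the
  coordinates permutes the three pairs, because \<open>(1, 1, 1)\<close> is the only body diagonal used.
\<close>

fun half_labels :: "bool \<times> int \<Rightarrow> bool \<times> int \<Rightarrow> bool \<times> int \<Rightarrow> bool \<Rightarrow> triple list" where
  "half_labels (a1, f1) (a2, f2) (a3, f3) b =
     (if a1 then [(1, 0, 0)] else []) @ (if a2 then [(0, 1, 0)] else []) @
     (if a3 then [(0, 0, 1)] else []) @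
     (if f1 = 0 then [] else [(0, 1, f1)]) @ (if f2 = 0 then [] else [(1, 0, f2)]) @
     (if f3 = 0 then [] else [(1, f3, 0)]) @ (if b then [(1, 1, 1)] else [])"

lemma mem_half_labels:
  "v \<in> set (half_labels (a1, f1) (a2, f2) (a3, f3) b) \<longleftrightarrow>
     a1 \<and> v = (1, 0, 0) \<or> a2 \<and> v = (0, 1, 0) \<or> a3 \<and> v = (0, 0, 1) \<or>
     f1 \<noteq> 0 \<and> v = (0, 1, f1) \<or> f2 \<noteq> 0 \<and> v = (1, 0, f2) \<or> f3 \<noteq> 0 \<and> v = (1, f3, 0) \<or>
     b \<and> v = (1, 1, 1)"
  by auto

definition codes :: "(bool \<times> int) list" where
  "codes = [(False, 0), (True, 0), (False, 1), (True, 1), (False, -1), (True, -1)]"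

lemma swap_half_labels_12:
  assumes "snd c3 \<in> {-1, 0, 1}"
  shows "integrally_equiv (label_set (half_labels c1 c2 c3 b)) (label_set (half_labels c2 c1 c3 b))"
proof (rule integrally_equiv_if_carries)
  obtain a1 f1 a2 f2 a3 f3 where c: "c1 = (a1, f1)" "c2 = (a2, f2)" "c3 = (a3, f3)"
    by (cases c1, cases c2, cases c3) auto
  have "f3 = -1 \<or> f3 = 0 \<or> f3 = 1" using assms by (auto simp: c)
  then show "carries ((0, 1, 0), (1, 0, 0), (0, 0, 1)) (half_labels c1 c2 c3 b) (half_labels c2 c1 c3 b)"
    unfolding c by (elim disjE; cases a1; cases a2; cases a3; cases b; cases "f1 = 0"; cases "f2 = 0")
      (simp_all add: carries_def)
qed

lemma swap_half_labels_23:
  assumes "snd c1 \<in> {-1, 0, 1}"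
  shows "integrally_equiv (label_set (half_labels c1 c2 c3 b)) (label_set (half_labels c1 c3 c2 b))"
proof (rule integrally_equiv_if_carries)
  obtain a1 f1 a2 f2 a3 f3 where c: "c1 = (a1, f1)" "c2 = (a2, f2)" "c3 = (a3, f3)"
    by (cases c1, cases c2, cases c3) auto
  have "f1 = -1 \<or> f1 = 0 \<or> f1 = 1" using assms by (auto simp: c)
  then show "carries ((1, 0, 0), (0, 0, 1), (0, 1, 0)) (half_labels c1 c2 c3 b) (half_labels c1 c3 c2 b)"
    unfolding c by (elim disjE; cases a1; cases a2; cases a3; cases b; cases "f2 = 0"; cases "f3 = 0")
      (simp_all add: carries_def)
qed

lemma sorted_triple_wlog:
  fixes P :: "nat \<Rightarrow> nat \<Rightarrow> nat \<Rightarrow> bool"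
  assumes swap12: "\<And>i j k. P j i k \<Longrightarrow> P i j k" and swap23: "\<And>i j k. P i k j \<Longrightarrow> P i j k"
    and sorted: "\<And>i j k. i \<le> j \<Longrightarrow> j \<le> k \<Longrightarrow> P i j k"
  shows "P i j k"
  by (metis assms nle_le)

lemma label_set_half_labels:
  fixes T :: "triple set"
  assumes box: "\<And>x y z. (x, y, z) \<in> T \<Longrightarrow> x \<in> {-1, 0, 1} \<and> y \<in> {-1, 0, 1} \<and> z \<in> {-1, 0, 1}"
    and nz: "(0, 0, 0) \<notin> T"
    and neg: "\<And>v. v \<in> T \<Longrightarrow> neg v \<in> T"
    and face: "(0, 1, 1) \<in> T \<Longrightarrow> (0, 1, -1) \<notin> T" "(1, 0, 1) \<in> T \<Longrightarrow> (1, 0, -1) \<notin> T"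
      "(1, 1, 0) \<in> T \<Longrightarrow> (1, -1, 0) \<notin> T"
    and body: "\<And>x y z. (x, y, z) \<in> T \<Longrightarrow> x \<noteq> 0 \<Longrightarrow> y \<noteq> 0 \<Longrightarrow> z \<noteq> 0 \<Longrightarrow> x = y \<and> y = z"
  shows "\<exists>c1\<in>set codes. \<exists>c2\<in>set codes. \<exists>c3\<in>set codes. \<exists>b.
    vec_of ` T = label_set (half_labels c1 c2 c3 b)"
proof -
  define sgn where "sgn v w = (if v \<in> T then 1 else if w \<in> T then -1 else 0 :: int)" for v w
  let ?c1 = "((1, 0, 0) \<in> T, sgn (0, 1, 1) (0, 1, -1))"
  let ?c2 = "((0, 1, 0) \<in> T, sgn (1, 0, 1) (1, 0, -1))"
  let ?c3 = "((0, 0, 1) \<in> T, sgn (1, 1, 0) (1, -1, 0))"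
  let ?L = "half_labels ?c1 ?c2 ?c3 ((1, 1, 1) \<in> T)"
  have neg_iff: "neg v \<in> T \<longleftrightarrow> v \<in> T" for v
    using neg[of v] neg[of "neg v"] by auto
  have negs: "(- x, - y, - z) \<in> T \<longleftrightarrow> (x, y, z) \<in> T" for x y z
    using neg_iff[of "(x, y, z)"] by simp
  have sgn: "(0, 1, 1) \<in> T \<Longrightarrow> sgn (0, 1, 1) (0, 1, -1) = 1" "(0, 1, -1) \<in> T \<Longrightarrow> sgn (0, 1, 1) (0, 1, -1) = -1"
    "(1, 0, 1) \<in> T \<Longrightarrow> sgn (1, 0, 1) (1, 0, -1) = 1" "(1, 0, -1) \<in> T \<Longrightarrow> sgn (1, 0, 1) (1, 0, -1) = -1"
    "(1, 1, 0) \<in> T \<Longrightarrow> sgn (1, 1, 0) (1, -1, 0) = 1" "(1, -1, 0) \<in> T \<Longrightarrow> sgn (1, 1, 0) (1, -1, 0) = -1"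
    using face by (auto simp: sgn_def)
  have "set ?L \<subseteq> T"
    by (auto simp: sgn_def split: if_splits)
  then have "set ?L \<union> neg ` set ?L \<subseteq> T"
    using neg by blast
  moreover have "v \<in> set ?L \<union> neg ` set ?L" if "v \<in> T" for v
  proof -
    obtain x y z where v: "v = (x, y, z)" by (cases v) auto
    have T: "(x, y, z) \<in> T" "(- x, - y, - z) \<in> T" using that negs by (simp_all add: v)
    have "x = -1 \<or> x = 0 \<or> x = 1" "y = -1 \<or> y = 0 \<or> y = 1" "z = -1 \<or> z = 0 \<or> z = 1"
      using box[of x y z] T by auto
    moreover have "x \<noteq> 0 \<Longrightarrow> y \<noteq> 0 \<Longrightarrow> z \<noteq> 0 \<Longrightarrow> x = y \<and> y = z"
      by (rule body[OF T(1)])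
    ultimately have "(x, y, z) \<in> set ?L \<or> (- x, - y, - z) \<in> set ?L"
      unfolding mem_half_labels using T nz by (elim disjE) (simp_all add: sgn)
    then show ?thesis
      unfolding v by (metis UnCI imageI minus_minus neg.simps)
  qed
  ultimately have "T = set ?L \<union> neg ` set ?L" by blast
  then have "vec_of ` T = label_set ?L" by (simp add: label_set_def)
  moreover have "c \<in> set codes" if "snd c \<in> {-1, 0, 1}" for c
    using that by (cases c) (auto simp: codes_def)
  then have "?c1 \<in> set codes" "?c2 \<in> set codes" "?c3 \<in> set codes"
    by (simp_all add: sgn_def)
  ultimately show ?thesis by blast
qed

text \<open>
  If a body diagonal is present, then changing the signs of the coordinates turns it into
  \<open>(1, 1, 1)\<close>; it is the only one, since all body diagonals agree modulo 2.
\<close>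

lemma admissible_normal_form:
  assumes "admissible E"
  shows "\<exists>c1\<in>set codes. \<exists>c2\<in>set codes. \<exists>c3\<in>set codes. \<exists>b.
    integrally_equiv E (label_set (half_labels c1 c2 c3 b))"
proof -
  define T where "T = {v. vec_of v \<in> E}"
  have box: "x \<in> {-1, 0, 1} \<and> y \<in> {-1, 0, 1} \<and> z \<in> {-1, 0, 1}" if "(x, y, z) \<in> T" for x y z
  proof -
    have "\<forall>i. \<bar>vec_of (x, y, z) $ i\<bar> \<le> 1"
      using that assms by (simp add: T_def admissible_def)
    then show ?thesis by (auto simp: forall_3)
  qed
  have nz: "(0, 0, 0) \<notin> T"
  proof
    assume "(0, 0, 0) \<in> T"
    moreover have "vec_of (0, 0, 0) = 0" by (simp add: vec_eq_iff forall_3)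
    ultimately show False using assms by (auto simp: T_def admissible_def)
  qed
  have neg: "neg v \<in> T" if "v \<in> T" for v
    using that assms by (simp add: T_def admissible_def vec_of_neg)
  have uniq: "w = v \<or> w = neg v"
    if "v \<in> T" "w \<in> T" "v = (x, y, z)" "w = (x', y', z')"
      "even (x - x')" "even (y - y')" "even (z - z')" for v w x y z x' y' z'
  proof -
    have "\<forall>i. even (vec_of v $ i - vec_of w $ i)" using that by (simp add: forall_3)
    then have "vec_of w = vec_of v \<or> vec_of w = vec_of (neg v)"
      unfolding vec_of_neg using that assms unfolding T_def admissible_def mem_Collect_eq by blast
    then show ?thesis by simp
  qed
  obtain p q r where sgn: "p \<in> {-1, 1}" "q \<in> {-1, 1}" "r \<in> {-1, 1::int}"
    and body: "\<And>x y z. (x, y, z) \<in> T \<Longrightarrow> x \<noteq> 0 \<Longrightarrow> y \<noteq> 0 \<Longrightarrow> z \<noteq> 0 \<Longrightarrow> p * x = q * y \<and> q * y = r * z"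
  proof (cases "\<exists>x y z. (x, y, z) \<in> T \<and> x \<noteq> 0 \<and> y \<noteq> 0 \<and> z \<noteq> 0")
    case True
    then obtain p q r where pqr: "(p, q, r) \<in> T" "p \<noteq> 0" "q \<noteq> 0" "r \<noteq> 0" by blast
    then have s: "p \<in> {-1, 1}" "q \<in> {-1, 1}" "r \<in> {-1, 1}" using box by auto
    have unit: "odd s" "s * s = 1" if "s \<in> {-1, 1}" for s :: int
      using that by auto
    show thesis
    proof (rule that[OF s])
      fix x y z assume xyz: "(x, y, z) \<in> T" "x \<noteq> 0" "y \<noteq> 0" "z \<noteq> 0"
      then have "x \<in> {-1, 1}" "y \<in> {-1, 1}" "z \<in> {-1, 1}" using box by auto
      then have "(x, y, z) = (p, q, r) \<or> (x, y, z) = neg (p, q, r)"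
        by (intro uniq[OF pqr(1) xyz(1) refl refl]) (simp_all add: s unit(1) del: insert_iff)
      moreover have "p * p = 1" "q * q = 1" "r * r = 1" by (simp_all add: s unit(2) del: insert_iff)
      ultimately show "p * x = q * y \<and> q * y = r * z" by auto
    qed
  next
    case False
    then show thesis using that[of 1 1 1] by auto
  qed
  \<comment> \<open>The diagonal matrix with entries \<open>p\<close>, \<open>q\<close>, \<open>r\<close> is its own inverse.\<close>
  let ?D = "((p, 0, 0), (0, q, 0), (0, 0, r))"
  define T' where "T' = apply_rows ?D ` T"
  have T': "(x, y, z) \<in> T' \<longleftrightarrow> (p * x, q * y, r * z) \<in> T" for x y z
    using sgn by (auto simp: T'_def image_iff) force+
  have "vec_of ` T' = (*v) (mat_of ?D) ` (vec_of ` T)"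
    by (simp add: T'_def image_image mat_of_mult_vec)
  also have "vec_of ` T = E"
  proof (intro equalityI subsetI)
    fix m assume "m \<in> E"
    moreover obtain v where "m = vec_of v" by (rule vec_of_surj)
    ultimately show "m \<in> vec_of ` T" by (simp add: T_def)
  qed (auto simp: T_def)
  finally have E: "vec_of ` T' = (*v) (mat_of ?D) ` E" .
  have "unimodular (mat_of ?D)"
    using sgn by (auto simp: unimodular_def det_mat_of)
  with E have equiv: "integrally_equiv E (vec_of ` T')"
    unfolding integrally_equiv_def by blast
  have face: "\<not> ((x, y, z) \<in> T' \<and> (x', y', z') \<in> T')"
    if "even (x - x')" "even (y - y')" "even (z - z')"
      "(x', y', z') \<noteq> (x, y, z)" "(x', y', z') \<noteq> neg (x, y, z)" for x y z x' y' z'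
  proof
    assume "(x, y, z) \<in> T' \<and> (x', y', z') \<in> T'"
    then have "(p * x', q * y', r * z') = (p * x, q * y, r * z) \<or>
               (p * x', q * y', r * z') = neg (p * x, q * y, r * z)"
      using that(1-3) unfolding T'
      by (intro uniq[OF _ _ refl refl]) (simp_all flip: right_diff_distrib)
    moreover have "s * u = s * u' \<longleftrightarrow> u = u'" "s * u = - (s * u') \<longleftrightarrow> u = - u'"
      if "s \<in> {-1, 1}" for s u u' :: int
      using that by (elim insertE emptyE, auto)+
    ultimately show False using that(4,5) sgn by (auto simp del: insert_iff)
  qed
  have "\<exists>c1\<in>set codes. \<exists>c2\<in>set codes. \<exists>c3\<in>set codes. \<exists>b.
      vec_of ` T' = label_set (half_labels c1 c2 c3 b)"
  proof (rule label_set_half_labels)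
    show "x \<in> {-1, 0, 1} \<and> y \<in> {-1, 0, 1} \<and> z \<in> {-1, 0, 1}" if "(x, y, z) \<in> T'" for x y z
    proof -
      have "(p * x, q * y, r * z) \<in> T" using that by (simp only: T')
      moreover have "s * u \<in> {-1, 0, 1} \<longleftrightarrow> u \<in> {-1, 0, 1}" if "s \<in> {-1, 1}" for s u :: int
        using that by (elim insertE emptyE) auto
      ultimately show ?thesis using box sgn by metis
    qed
    show "(0, 0, 0) \<notin> T'" using nz by (simp add: T')
    show "neg v \<in> T'" if "v \<in> T'" for v
    proof -
      obtain x y z where v: "v = (x, y, z)" by (cases v) auto
      show ?thesis using neg[of "(p * x, q * y, r * z)"] that by (simp add: v T')
    qed
    show "x = y \<and> y = z" if "(x, y, z) \<in> T'" "x \<noteq> 0" "y \<noteq> 0" "z \<noteq> 0" for x y z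
    proof -
      have "(p * x, q * y, r * z) \<in> T" using that(1) by (simp only: T')
      from body[OF this] show ?thesis using sgn that(2-) by auto
    qed
    show "(0, 1, 1) \<in> T' \<Longrightarrow> (0, 1, -1) \<notin> T'" "(1, 0, 1) \<in> T' \<Longrightarrow> (1, 0, -1) \<notin> T'"
      "(1, 1, 0) \<in> T' \<Longrightarrow> (1, -1, 0) \<notin> T'"
      using face[of 0 0 1 1 1 "-1"] face[of 1 1 0 0 1 "-1"] face[of 1 1 1 "-1" 0 0] by auto
  qed
  with equiv show ?thesis by metis
qed

section \<open>Reduction to nineteen representatives\<close>

text \<open>
  The first three vectors of each list form a basis of \<open>\<int>\<^sup>3\<close>, as \<open>valid_list\<close> below requires.  The lists are
  ordered by length and then by the determinant of \<open>\<Sum>v. v v\<^sup>T\<close>.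
\<close>

definition representatives :: "triple list list" where
  "representatives = [
    [(1, 0, 0), (0, 1, 0), (0, 0, 1)],
    [(1, 0, 0), (0, 1, 0), (0, 0, 1), (0, 1, 1)],
    [(1, 0, 0), (0, 1, 0), (0, 0, 1), (1, 1, 1)],
    [(1, 0, 0), (0, 1, 0), (0, 1, 1), (1, -1, 1)],
    [(0, 1, 0), (1, 1, 0), (0, 1, 1), (1, -1, 1)],
    [(1, 0, 0), (1, 1, 0), (0, 1, 1), (1, -1, 1)],
    [(1, 0, 0), (0, 1, 0), (0, 0, 1), (1, 0, 1), (0, 1, 1)],
    [(1, 0, 0), (0, 1, 0), (0, 0, 1), (0, 1, 1), (1, -1, 1)],
    [(1, 0, 0), (0, 1, 0), (0, 1, 1), (1, 1, 0), (1, -1, 1)],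
    [(1, 0, 0), (0, 0, 1), (1, 1, 0), (0, 1, 1), (1, -1, 1)],
    [(1, 0, 0), (1, 1, 0), (1, 0, -1), (0, 1, 1), (1, -1, 1)],
    [(1, 0, 0), (0, 1, 0), (0, 0, 1), (1, 1, 0), (0, 1, 1), (1, 1, 1)],
    [(1, 0, 0), (0, 1, 0), (0, 0, 1), (1, 1, 0), (1, 0, 1), (0, 1, 1)],
    [(1, 0, 0), (0, 1, 0), (0, 0, 1), (1, 1, 0), (0, 1, 1), (1, -1, 1)],
    [(1, 0, 0), (0, 0, 1), (1, 1, 0), (1, 0, 1), (0, 1, 1), (1, -1, 1)],
    [(1, 0, 0), (0, 0, 1), (1, 1, 0), (1, 0, -1), (0, 1, 1), (1, -1, 1)],
    [(1, 0, 0), (0, 1, 0), (0, 0, 1), (1, 1, 0), (1, 0, 1), (0, 1, 1), (1, 1, 1)],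
    [(1, 0, 0), (0, 1, 0), (0, 0, 1), (1, 1, 0), (1, 0, 1), (0, 1, 1), (1, -1, 1)],
    [(1, 0, 0), (0, 1, 0), (0, 0, 1), (1, 1, 0), (1, 0, -1), (0, 1, 1), (1, -1, 1)]]"

text \<open>
  For each normal form that generates \<open>\<int>\<^sup>3\<close> there are several matrices that carry it to its representative,
  one for each symmetry of the representative.  These sixteen form a small selection that covers all
  normal forms, each after a suitable change of signs.
\<close>

definition transformations :: "(triple \<times> triple \<times> triple) list" where
  "transformations = [
    ((0, 0, 1), (-1, 0, 0), (0, 1, 0)),
    ((0, 1, 0), (-1, 1, 0), (-1, 1, 1)),
    ((0, 1, 0), (0, 0, -1), (1, 1, -1)),
    ((1, 0, 0), (0, 0, -1), (1, -1, 0)),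
    ((0, 1, 0), (1, 0, 0), (0, 1, -1)),
    ((1, -1, 0), (1, 0, -1), (1, 0, 0)),
    ((1, 1, -1), (1, 0, 0), (1, 0, -1)),
    ((1, 0, -1), (-1, -1, 1), (0, 0, -1)),
    ((1, -1, 0), (1, -1, -1), (1, 0, -1)),
    ((0, 0, 1), (-1, 0, 1), (0, 1, 0)),
    ((0, 0, 1), (-1, 1, 0), (-1, 0, 1)),
    ((1, 1, -1), (-1, 0, 0), (0, 1, 0)),
    ((1, 1, -1), (1, 0, -1), (1, 1, -2)),
    ((1, -1, 0), (0, 1, 0), (1, 0, -1)),
    ((0, 0, 1), (1, 1, -2), (1, 0, -1)),
    ((0, 0, 1), (1, -1, -1), (0, -1, 0))]"

text \<open>
  A normal form without body diagonal leaves the signs of the coordinates free.  Since \<open>-1\<close> acts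
  trivially on label sets, one sign can be fixed.
\<close>

definition sign_changes :: "(triple \<times> triple \<times> triple) list" where
  "sign_changes = [((1, 0, 0), (0, 1, 0), (0, 0, 1)), ((1, 0, 0), (0, -1, 0), (0, 0, 1)),
     ((1, 0, 0), (0, 1, 0), (0, 0, -1)), ((1, 0, 0), (0, -1, 0), (0, 0, -1))]"

text \<open>
  Functionals and moduli that witness failure to generate \<open>\<int>\<^sup>3\<close>.  The modulus 3 is needed for sets such
  as \<open>{(1, -1, 0), (1, 0, -1), (1, 1, 1)}\<close>, which generate modulo 2 but have index 3.
\<close>

definition functionals :: "(triple \<times> int) list" where
  "functionals = [((1, 0, 0), 2), ((0, 0, 1), 2), ((1, -1, 0), 2), ((1, -1, -1), 2), ((1, 1, 1), 3)]"

definition degenerate :: "triple list \<Rightarrow> bool" where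
  "degenerate L \<longleftrightarrow> (\<exists>(c, p)\<in>set functionals. \<forall>v\<in>set L. dot c v mod p = 0)"

definition reducible :: "triple list \<Rightarrow> bool" where
  "reducible L \<longleftrightarrow> (\<exists>R\<in>set representatives. length R = length L \<and>
     (\<exists>D\<in>set sign_changes. \<exists>M\<in>set transformations. carries M (map (apply_rows D) L) R))"

text \<open>
  The finite computation behind the upper bound.  By symmetry only nondecreasing triples of indices
  are considered, which leaves 56 triples, each with and without the body diagonal.
\<close>

lemma sorted_codes_classified:
  "\<forall>i\<in>set [0..<6]. \<forall>j\<in>set [i..<6]. \<forall>k\<in>set [j..<6]. \<forall>b\<in>set [False, True].
     degenerate (half_labels (codes ! i) (codes ! j) (codes ! k) b) \<or>
     reducible (half_labels (codes ! i) (codes ! j) (codes ! k) b)"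
  by code_simp

lemma reducible_imp_equiv_representative:
  assumes "reducible L"
  shows "\<exists>R\<in>set representatives. integrally_equiv (label_set L) (label_set R)"
proof -
  obtain R D M where R: "R \<in> set representatives" and D: "D \<in> set sign_changes"
    and M: "carries M (map (apply_rows D) L) R"
    using assms by (auto simp: reducible_def)
  have "\<bar>det_rows D\<bar> = 1" using D by (auto simp: sign_changes_def)
  then have "carries D L (map (apply_rows D) L)" by (auto simp: carries_def)
  then show ?thesis
    using M R integrally_equiv_if_carries integrally_equiv_trans by blast
qed

lemma not_generates_degenerate:
  assumes "degenerate L" shows "\<not> generates (label_set L)"
proof -
  obtain c p where cp: "(c, p) \<in> set functionals" "\<forall>v\<in>set L. dot c v mod p = 0"
    using assms by (auto simp: degenerate_def)
  then have "p > 1" "\<bar>dot c (1, 0, 0)\<bar> = 1 \<or> \<bar>dot c (0, 1, 0)\<bar> = 1 \<or> \<bar>dot c (0, 0, 1)\<bar> = 1"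
    by (auto simp: functionals_def)
  with cp(2) show ?thesis by (intro not_generates_label_set)
qed

lemma codes_classified:
  assumes "c1 \<in> set codes" "c2 \<in> set codes" "c3 \<in> set codes"
    and gen: "generates (label_set (half_labels c1 c2 c3 b))"
  shows "\<exists>R\<in>set representatives. integrally_equiv (label_set (half_labels c1 c2 c3 b)) (label_set R)"
proof -
  define S where "S i j k = label_set (half_labels (codes ! i) (codes ! j) (codes ! k) b)" for i j k
  define P where "P i j k \<longleftrightarrow> i < 6 \<longrightarrow> j < 6 \<longrightarrow> k < 6 \<longrightarrow> generates (S i j k) \<longrightarrow>
    (\<exists>R\<in>set representatives. integrally_equiv (S i j k) (label_set R))" for i j k
  have codes: "snd c \<in> {-1, 0, 1}" if "c \<in> set codes" for c
    using that by (auto simp: codes_def)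
  have len: "length codes = 6" by (simp add: codes_def)
  have nth: "codes ! i \<in> set codes" if "i < 6" for i
    using that by (simp add: len)
  have transport: "P i j k" if "P i' j' k'" and "i < 6 \<Longrightarrow> j < 6 \<Longrightarrow> k < 6 \<Longrightarrow> i' < 6 \<and> j' < 6 \<and> k' < 6"
    and "i < 6 \<Longrightarrow> j < 6 \<Longrightarrow> k < 6 \<Longrightarrow> integrally_equiv (S i j k) (S i' j' k')" for i j k i' j' k'
    using that generates_integrally_equiv integrally_equiv_trans unfolding P_def by meson
  have "P i j k" for i j k
  \<comment> \<open>Swapping coordinates permutes the codes, so nondecreasing indices suffice.\<close>
  proof (rule sorted_triple_wlog)
    fix i j k
    show "P i j k" if "P j i k"
      by (rule transport[OF that]) (simp_all add: S_def swap_half_labels_12 codes nth del: insert_iff)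
    show "P i j k" if "P i k j"
      by (rule transport[OF that]) (simp_all add: S_def swap_half_labels_23 codes nth del: insert_iff)
    assume le: "i \<le> j" "j \<le> k"
    show "P i j k"
      unfolding P_def
    proof (intro impI)
      assume k: "i < 6" "j < 6" "k < 6" and gen: "generates (S i j k)"
      let ?L = "half_labels (codes ! i) (codes ! j) (codes ! k) b"
      have "degenerate ?L \<or> reducible ?L"
        using sorted_codes_classified le k by (cases b) auto
      then show "\<exists>R\<in>set representatives. integrally_equiv (S i j k) (label_set R)"
        using gen not_generates_degenerate reducible_imp_equiv_representative unfolding S_def by blast
    qed
  qed
  moreover obtain i j k where "i < 6" "codes ! i = c1" "j < 6" "codes ! j = c2" "k < 6" "codes ! k = c3"
    using assms(1-3) by (auto simp: in_set_conv_nth len)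
  ultimately show ?thesis using gen unfolding P_def S_def by metis
qed

lemma admissible_equiv_representative:
  assumes "admissible E"
  shows "\<exists>R\<in>set representatives. integrally_equiv E (label_set R)"
proof -
  obtain c1 c2 c3 b where c: "c1 \<in> set codes" "c2 \<in> set codes" "c3 \<in> set codes"
    and equiv: "integrally_equiv E (label_set (half_labels c1 c2 c3 b))"
    using admissible_normal_form[OF assms] by blast
  have "generates (label_set (half_labels c1 c2 c3 b))"
    using equiv assms by (auto simp: admissible_def intro: generates_integrally_equiv)
  then show ?thesis
    using codes_classified[OF c] equiv integrally_equiv_trans by blast
qed

section \<open>The representatives are admissible and inequivalent\<close>

fun congruent_mod_2 :: "triple \<Rightarrow> triple \<Rightarrow> bool" where
  "congruent_mod_2 (a, b, c) (x, y, z) \<longleftrightarrow> even (a - x) \<and> even (b - y) \<and> even (c - z)"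

fun in_box :: "triple \<Rightarrow> bool" where
  "in_box (a, b, c) \<longleftrightarrow> (a, b, c) \<noteq> (0, 0, 0) \<and> \<bar>a\<bar> \<le> 1 \<and> \<bar>b\<bar> \<le> 1 \<and> \<bar>c\<bar> \<le> 1"

definition valid_list :: "triple list \<Rightarrow> bool" where
  "valid_list L \<longleftrightarrow> distinct (L @ map neg L) \<and> (\<forall>v\<in>set L. in_box v) \<and>
     (\<forall>v\<in>set L. \<forall>w\<in>set L. congruent_mod_2 v w \<longrightarrow> v = w) \<and>
     3 \<le> length L \<and> \<bar>det_rows (L ! 0, L ! 1, L ! 2)\<bar> = 1"

lemma valid_representatives: "\<forall>R\<in>set representatives. valid_list R"
  by code_simp

lemma admissible_label_set:
  assumes "valid_list L" shows "admissible (label_set L)"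
proof -
  have lift: "\<exists>v\<in>set L. m = vec_of v \<or> m = - vec_of v" if "m \<in> label_set L" for m
  proof -
    obtain v where v: "m = vec_of v" by (rule vec_of_surj)
    with that have "v \<in> set L \<or> neg v \<in> set L" by (simp add: mem_label_set)
    then show ?thesis by (metis v minus_minus vec_of_neg)
  qed
  have box: "vec_of v \<noteq> 0 \<and> (\<forall>i. \<bar>vec_of v $ i\<bar> \<le> 1)" if "v \<in> set L" for v
  proof -
    have "in_box v" using assms that by (simp add: valid_list_def)
    then show ?thesis by (cases v) (auto simp: forall_3 vec_eq_iff)
  qed
  have cong: "congruent_mod_2 v w" if "\<forall>i. even (vec_of v $ i - vec_of w $ i)" for v w
    using that by (cases v; cases w) (auto simp: forall_3)
  show ?thesis
    unfolding admissible_def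
  proof (intro conjI ballI allI impI)
    fix m assume "m \<in> label_set L"
    then obtain v where v: "v \<in> set L" "m = vec_of v \<or> m = - vec_of v" using lift by blast
    then show "m \<noteq> 0" using box[of v] by auto
    show "\<bar>m $ i\<bar> \<le> 1" for i using v box[of v] by auto
    show "- m \<in> label_set L" using \<open>m \<in> label_set L\<close> by (rule minus_in_label_set)
  next
    fix m n assume m: "m \<in> label_set L" and n: "n \<in> label_set L" and even: "\<forall>i. even (m $ i - n $ i)"
    obtain v where v: "v \<in> set L" "m = vec_of v \<or> m = - vec_of v" using lift m by blast
    obtain w where w: "w \<in> set L" "n = vec_of w \<or> n = - vec_of w" using lift n by blast
    have "\<forall>i. even (vec_of v $ i - vec_of w $ i)"
      using v(2) w(2) even by (elim disjE) simp_all
    then have "v = w" using assms v(1) w(1) cong by (auto simp: valid_list_def)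
    then show "n = m \<or> n = - m" using v(2) w(2) by (metis minus_minus)
  next
    have "L ! 0 \<in> set L" "L ! 1 \<in> set L" "L ! 2 \<in> set L"
      using assms by (auto simp: valid_list_def intro!: nth_mem)
    moreover have "\<bar>det_rows (L ! 0, L ! 1, L ! 2)\<bar> = 1"
      using assms by (simp only: valid_list_def)
    ultimately show "generates (label_set L)"
      by (rule generates_label_set)
  qed
qed

text \<open>
  Executable versions of the two invariants.
\<close>

definition moment :: "(triple \<Rightarrow> int) \<Rightarrow> triple list \<Rightarrow> int" where
  "moment f L = sum_list (map f L)"

definition gram_rows :: "triple list \<Rightarrow> triple \<times> triple \<times> triple" where
  "gram_rows L =
     (let xx = moment (\<lambda>(x, y, z). x * x) L; xy = moment (\<lambda>(x, y, z). x * y) L;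
          xz = moment (\<lambda>(x, y, z). x * z) L; yy = moment (\<lambda>(x, y, z). y * y) L;
          yz = moment (\<lambda>(x, y, z). y * z) L; zz = moment (\<lambda>(x, y, z). z * z) L
      in ((xx, xy, xz), (xy, yy, yz), (xz, yz, zz)))"

definition invariants :: "triple list \<Rightarrow> nat \<times> int" where
  "invariants L = (length (L @ map neg L), det_rows (gram_rows (L @ map neg L)))"

text \<open>
  The determinants agree for some representatives with different numbers of labels, but the
  pairs are distinct.
\<close>

lemma distinct_invariants: "distinct (map invariants representatives)"
  by code_simp

lemma invariants_eq:
  assumes "valid_list L"
  shows "invariants L = (card (label_set L), det (gram_matrix (label_set L)))"
proof -
  let ?L = "L @ map neg L"
  have dist: "distinct ?L" using assms by (simp add: valid_list_def)
  have set: "label_set L = vec_of ` set ?L" by (simp add: label_set_def)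
  have inj: "inj_on vec_of (set ?L)" by (rule inj_onI) simp
  have "card (label_set L) = length ?L"
    unfolding set by (simp only: card_image[OF inj] distinct_card[OF dist])
  moreover have "gram_matrix (label_set L) = mat_of (gram_rows ?L)"
  proof -
    have moment: "(\<Sum>v\<in>label_set L. f v) = moment (\<lambda>v. f (vec_of v)) ?L" for f
      unfolding set moment_def sum.reindex[OF inj] comp_def
      by (rule sum.distinct_set_conv_list[OF dist])
    show ?thesis
      by (simp add: vec_eq_iff forall_3 gram_matrix_def moment mat_of_def gram_rows_def
          Let_def case_prod_beta' vec_of_def mult.commute del: map_append)
  qed
  ultimately show ?thesis
    by (simp add: invariants_def det_mat_of del: map_append)
qed

lemma representatives_inequivalent:
  assumes "R \<in> set representatives" "R' \<in> set representatives"
    and "integrally_equiv (label_set R) (label_set R')"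
  shows "R = R'"
proof -
  have "invariants R' = invariants R"
    using assms valid_representatives integrally_equiv_invariants[OF assms(3)]
    by (simp add: invariants_eq)
  moreover have "inj_on invariants (set representatives)"
    using distinct_invariants by (simp add: distinct_map)
  ultimately show ?thesis using assms(1,2) by (metis inj_onD)
qed

section \<open>Counting the classes\<close>

theorem theorem9p5:
  shows "card ({\<N> :: net. lattice_net \<N> \<and> connected_net \<N> \<and> adjacency_depth \<N> = 1}
               // {(\<N>\<^sub>1, \<N>\<^sub>2). oriented_affine_equiv \<N>\<^sub>1 \<N>\<^sub>2}) = 19"
proof -
  let ?A = "{\<N> :: net. lattice_net \<N> \<and> connected_net \<N> \<and> adjacency_depth \<N> = 1}"
  let ?r = "{(\<N>\<^sub>1 :: net, \<N>\<^sub>2). oriented_affine_equiv \<N>\<^sub>1 \<N>\<^sub>2}"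
  define net_of where "net_of R = label_net (label_set R)" for R
  define class_of where "class_of \<N> = ?r `` {\<N>}" for \<N>
  note equiv = equiv_oriented_affine_equiv
  have class_eq: "class_of \<N> = class_of \<M> \<longleftrightarrow> oriented_affine_equiv \<N> \<M>" for \<N> \<M>
    using eq_equiv_class_iff[OF equiv, of \<N> \<M>] by (simp add: class_of_def)
  have adm: "admissible (label_set R)" if "R \<in> set representatives" for R
    using that valid_representatives admissible_label_set by blast
  have "?A // ?r = class_of ` ?A"
    by (auto simp: quotient_def class_of_def)
  also have "\<dots> = (class_of \<circ> net_of) ` set representatives"
  proof (intro equalityI subsetI)
    fix c assume "c \<in> class_of ` ?A"
    then obtain \<N> where \<N>: "\<N> \<in> ?A" "c = class_of \<N>" by blast
    obtain E where E: "admissible E" "oriented_affine_equiv (label_net E) \<N>"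
      using net_equiv_admissible_label_net \<N>(1) by blast
    obtain R where R: "R \<in> set representatives" "integrally_equiv E (label_set R)"
      using admissible_equiv_representative[OF E(1)] by blast
    obtain g where "unimodular g" "label_set R = (*v) g ` E"
      using R(2) unfolding integrally_equiv_def by blast
    then have "oriented_affine_equiv (label_net E) (net_of R)"
      using label_net_equiv_if_unimodular_image[of g E] minus_label[OF E(1)] by (simp add: net_of_def)
    with E(2) have "class_of \<N> = class_of (net_of R)"
      using class_eq by metis
    with R(1) \<N>(2) show "c \<in> (class_of \<circ> net_of) ` set representatives" by auto
  next
    fix c assume "c \<in> (class_of \<circ> net_of) ` set representatives"
    then obtain R where "R \<in> set representatives" "c = class_of (net_of R)" by auto
    moreover from this have "net_of R \<in> ?A"
      using adm lattice_net_label_net connected_label_net adjacency_depth_label_net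
      by (simp add: net_of_def)
    ultimately show "c \<in> class_of ` ?A" by blast
  qed
  also have "card \<dots> = card (set representatives)"
  proof (rule card_image, rule inj_onI)
    fix R R' assume R: "R \<in> set representatives" "R' \<in> set representatives"
      and "(class_of \<circ> net_of) R = (class_of \<circ> net_of) R'"
    then have "oriented_affine_equiv (label_net (label_set R)) (label_net (label_set R'))"
      by (simp add: class_eq net_of_def)
    then obtain g where "unimodular g" "label_set R' = (*v) g ` label_set R"
      using unimodular_image_if_label_nets_equiv minus_in_label_set by metis
    then have "integrally_equiv (label_set R) (label_set R')"
      unfolding integrally_equiv_def by blast
    with R show "R = R'" by (rule representatives_inequivalent)
  qed
  also have "\<dots> = length representatives"
    using distinct_invariants by (simp add: distinct_card distinct_map)
  also have "\<dots> = 19" by (simp add: representatives_def)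
  finally show ?thesis .
qed

end
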